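(* Consider the short hashing model in which the projection matrix $\mathcal{P}$ is a $k\times n$ Toeplitz matrix of independent standard Gaussians. Let $p,r\in\mathbb{R}^n$ be $L_2$-normalized vectors with angle $\theta_{p,r}$ between them. Then for every $c>0$, $$\mathbb{P}\Big(\big|\tilde{\theta}^{n}_{p,r}-\tfrac{\theta_{p,r}}{\pi}\big|\ge c\Big(\tfrac{\sqrt{\log k}}{k}\Big)^{\frac13}\Big)=O\Big(\frac{1}{c^{2}}\Big),$$ with an absolute implied constant.
   Context: Let $k\le n$, $t=n+k-1$, and $g_1,\dots,g_t$ independent $\mathcal{N}(0,1)$. The Toeplitz projection matrix is $\mathcal{P}_{i,j}=g_{j-i+k}$ for $1\le i\le k$, $1\le j\le n$. Let $\mathcal{D}$ be an $n\times n$ diagonal matrix with independent uniform $\{-1,1\}$ diagonal entries, independent of the $g_l$. With $\mathrm{sign}(x)=1$ for $x\ge0$ and $-1$ for $x<0$ (coordinatewise), the short hashing model is $h(x)=\mathrm{sign}(\mathcal{P}\mathcal{D}x)\in\{-1,1\}^k$, and the normalized approximate angle is $\tilde{\theta}^{n}_{p,r}=\frac{1}{2k}\|h(p)-h(r)\|_1$.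
   Formalization: The formal theorem assumes k ≥ 2: for k = 1 the threshold c(√(log k)/k)^{1/3} is 0, so the event has probability 1 and no absolute bound O(1/c²) can hold for all c > 0. *)

theory Defs
  imports "HOL-Probability.Probability"
begin

definition sgn1 :: "real \<Rightarrow> real" where
  "sgn1 x = (if x \<ge> 0 then 1 else -1)"

text \<open>Sample space: a pair (g, d) where g l (1 \<le> l \<le> n+k-1) are the Gaussians
  and d j (1 \<le> j \<le> n) are the Rademacher diagonal entries of D.\<close>
definition hash_space :: "nat \<Rightarrow> nat \<Rightarrow> ((nat \<Rightarrow> real) \<times> (nat \<Rightarrow> real)) measure" where
  "hash_space n k =
     (PiM {1..n + k - 1} (\<lambda>_. std_normal_distribution)) \<Otimes>\<^sub>M
     (PiM {1..n} (\<lambda>_. measure_pmf (pmf_of_set {-1::real, 1})))"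

definition toeplitz_P :: "nat \<Rightarrow> (nat \<Rightarrow> real) \<Rightarrow> nat \<Rightarrow> nat \<Rightarrow> real" where
  "toeplitz_P k g i j = g (j + k - i)"

definition short_hash ::
  "nat \<Rightarrow> nat \<Rightarrow> (nat \<Rightarrow> real) \<times> (nat \<Rightarrow> real) \<Rightarrow> (nat \<Rightarrow> real) \<Rightarrow> nat \<Rightarrow> real" where
  "short_hash n k \<omega> x i = sgn1 (\<Sum>j=1..n. toeplitz_P k (fst \<omega>) i j * snd \<omega> j * x j)"

definition approx_angle ::
  "nat \<Rightarrow> nat \<Rightarrow> (nat \<Rightarrow> real) \<times> (nat \<Rightarrow> real) \<Rightarrow> (nat \<Rightarrow> real) \<Rightarrow> (nat \<Rightarrow> real) \<Rightarrow> real" where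
  "approx_angle n k \<omega> p r =
     (\<Sum>i=1..k. \<bar>short_hash n k \<omega> p i - short_hash n k \<omega> r i\<bar>) / (2 * real k)"

definition vec_angle :: "nat \<Rightarrow> (nat \<Rightarrow> real) \<Rightarrow> (nat \<Rightarrow> real) \<Rightarrow> real" where
  "vec_angle n p r = arccos (\<Sum>i=1..n. p i * r i)"

end

theory Submission
  imports Defs
begin

text \<open>
  For fixed signs \<open>d\<close>, each row of the hash produces a standard Gaussian pair whose correlation is the
  inner product of \<open>p\<close> and \<open>r\<close>, so every coordinate of the two hashes differs with probability exactly
  \<open>\<theta> / pi\<close>. Distinct rows are correlated only through inner products of shifted vectors
  \<open>\<Sum>\<^sub>j d\<^sub>j d\<^bsub>j+s\<^esub> x\<^sub>j y\<^bsub>j+s\<^esub>\<close>, whose second moments over the random signs sum to at most \<open>1\<close> over all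
  shifts \<open>s\<close>. The indicator that two signs differ is an even function of the Gaussian pair, so the
  covariance of two coordinates is quadratic, not just linear, in these correlations. Hence the mean
  square deviation of the approximate angle is \<open>O(1 / k)\<close>, which is
  \<open>O((sqrt (ln k) / k) powr (2 / 3))\<close>, and Chebyshev's inequality concludes.
\<close>

subsection \<open>Joint laws and characteristic functions\<close>

text \<open>The obstacle is that \<open>p\<close> and \<open>r\<close> may be nearly parallel: the
  two Gaussians of one row are then almost degenerate, and an estimate in terms of \<open>p\<close>
  and \<open>r\<close> directly would lose control. So each row is described by \<open>p\<close> and
  a unit vector \<open>q\<close> orthogonal to \<open>p\<close>, and \<open>r\<close> is absorbed
  into the test function; the bound then depends only on the correlations between different rows.
  For the quadratic bound, one row is conditioned on another. This moves its conditional mean, which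
  is realised as a translation of the whole Gaussian vector by some \<open>c\<close>. The densities
  of the translations by \<open>c\<close> and by \<open>- c\<close> average to a function within
  order \<open>dot I c c\<close> of 1 in mean, and an even function cannot tell the two translations
  apart. The value \<open>\<theta> / pi\<close> is obtained without polar coordinates, from a
  reflection and a doubling identity in the angle. All equalities in law are checked on cosines with
  an arbitrary phase, the real form of characteristic functions. The final constant is 65 = 1 + 16 *
  4: diagonal terms, covariance constant, four pairs from \<open>p\<close> and
  \<open>q\<close>.\<close>

lemma (in prob_space) integrable_bounded_by:
  fixes f :: "'a \<Rightarrow> real"
  assumes "f \<in> borel_measurable M" "\<And>x. x \<in> space M \<Longrightarrow> \<bar>f x\<bar> \<le> K"
  shows "integrable M f"
  using assms by (intro integrable_const_bound[where B = K]) auto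

text \<open>Absorbing a weight into the measure makes uniqueness theorems for probability laws apply
  to weighted expectations. The range from 1 to 3 is that of a weight in [-1, 1] shifted by
  2.\<close>

lemma (in prob_space) tilted_prob_space:
  fixes w :: "'a \<Rightarrow> real"
  assumes [measurable]: "w \<in> borel_measurable M" and w: "\<And>x. 1 \<le> w x" "\<And>x. w x \<le> 3"
  shows "expectation w \<ge> 1" "prob_space (density M (\<lambda>x. w x / expectation w))"
proof -
  have iw: "integrable M w"
  proof (rule integrable_bounded_by)
    show "\<bar>w x\<bar> \<le> 3" for x using w[of x] by auto
  qed simp
  have "expectation (\<lambda>x. 1) \<le> expectation w"
    using w by (intro integral_mono iw) auto
  then show Z: "expectation w \<ge> 1" by (simp add: prob_space)
  have "(\<integral>\<^sup>+ x. ennreal (w x / expectation w) \<partial>M) = ennreal (expectation (\<lambda>x. w x / expectation w))"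
    using Z w iw by (intro nn_integral_eq_integral) (auto intro!: divide_nonneg_pos AE_I2 intro: order_trans[of _ 1])
  also have "\<dots> = 1" using Z by simp
  finally have "emeasure (density M (\<lambda>x. w x / expectation w)) (space M) = 1"
    by (subst emeasure_density) (auto cong: nn_integral_cong)
  then show "prob_space (density M (\<lambda>x. w x / expectation w))"
    by (intro prob_spaceI) simp
qed

text \<open>A sine is a cosine with phase \<open>- (pi/2)\<close>, so cosine identities valid for
  every phase determine the whole characteristic function. The written \<open>+ 0\<close> brings the
  real part into the same form.\<close>

lemma (in prob_space) char_tilted:
  fixes w X :: "'a \<Rightarrow> real"
  assumes [measurable]: "w \<in> borel_measurable M" "X \<in> borel_measurable M"
    and w: "\<And>x. 1 \<le> w x" "\<And>x. w x \<le> 3"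
  shows "char (distr (density M (\<lambda>x. w x / expectation w)) borel X) t
    = Complex (expectation (\<lambda>x. w x * cos (t * X x + 0)) / expectation w)
        (expectation (\<lambda>x. w x * cos (t * X x + - (pi/2))) / expectation w)"
proof -
  let ?Z = "expectation w"
  have Z: "?Z \<ge> 1" using tilted_prob_space[of w] w by simp
  have "char (distr (density M (\<lambda>x. w x / ?Z)) borel X) t
      = (CLINT x|density M (\<lambda>x. w x / ?Z). iexp (t * X x))"
    unfolding char_def by (subst integral_distr) auto
  also have "\<dots> = (CLINT x|M. (w x / ?Z) *\<^sub>R iexp (t * X x))"
    using w Z by (subst integral_density) (auto intro!: AE_I2 divide_nonneg_pos intro: order_trans[of _ 1])
  also have "\<dots> = Complex (expectation (\<lambda>x. w x * cos (t * X x + 0)) / ?Z)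
        (expectation (\<lambda>x. w x * cos (t * X x + - (pi/2))) / ?Z)" (is "?I = _")
  proof -
    have i: "integrable M (\<lambda>x. (w x / ?Z) *\<^sub>R iexp (t * X x))"
    proof (rule integrable_const_bound[where B = 3])
      show "AE x in M. norm ((w x / ?Z) *\<^sub>R iexp (t * X x)) \<le> 3"
      proof (rule AE_I2)
        fix x
        have "0 \<le> w x" "w x \<le> 3" using w[of x] by auto
        then have "w x / ?Z \<le> 3 / 1" using Z by (intro frac_le) auto
        then show "norm ((w x / ?Z) *\<^sub>R iexp (t * X x)) \<le> 3"
          using \<open>0 \<le> w x\<close> Z by (simp add: norm_mult)
      qed
    qed simp
    have "Re ?I = expectation (\<lambda>x. Re ((w x / ?Z) *\<^sub>R iexp (t * X x)))"
      using i by (rule integral_Re[symmetric])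
    also have "\<dots> = expectation (\<lambda>x. w x * cos (t * X x + 0) / ?Z)"
      by (intro Bochner_Integration.integral_cong) (auto simp: Re_exp)
    finally have 1: "Re ?I = expectation (\<lambda>x. w x * cos (t * X x + 0)) / ?Z" by simp
    have "Im ?I = expectation (\<lambda>x. Im ((w x / ?Z) *\<^sub>R iexp (t * X x)))"
      using i by (rule integral_Im[symmetric])
    also have "\<dots> = expectation (\<lambda>x. w x * cos (t * X x + - (pi/2)) / ?Z)"
      by (intro Bochner_Integration.integral_cong) (auto simp: Im_exp cos_diff)
    finally have 2: "Im ?I = expectation (\<lambda>x. w x * cos (t * X x + - (pi/2))) / ?Z" by simp
    show ?thesis using 1 2 by (simp add: complex_eq_iff)
  qed
  finally show ?thesis .
qed

lemma (in prob_space) measure_tilted: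
  fixes w X :: "'a \<Rightarrow> real"
  assumes [measurable]: "w \<in> borel_measurable M" "X \<in> borel_measurable M" "B \<in> sets borel"
    and w: "\<And>x. 1 \<le> w x" "\<And>x. w x \<le> 3"
  shows "expectation (\<lambda>x. w x * indicator B (X x))
    = expectation w * measure (distr (density M (\<lambda>x. w x / expectation w)) borel X) B"
proof -
  let ?Z = "expectation w"
  have Z: "?Z \<ge> 1" using tilted_prob_space[of w] w by simp
  have "measure (distr (density M (\<lambda>x. w x / ?Z)) borel X) B
      = integral\<^sup>L (distr (density M (\<lambda>x. w x / ?Z)) borel X) (indicator B)"
    by simp
  also have "\<dots> = (\<integral>x. indicator B (X x) \<partial>density M (\<lambda>x. w x / ?Z))"
    by (subst integral_distr) auto
  also have "\<dots> = expectation (\<lambda>x. (w x / ?Z) *\<^sub>R indicator B (X x))"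
    using w Z by (subst integral_density) (auto intro!: AE_I2 divide_nonneg_pos intro: order_trans[of _ 1])
  also have "\<dots> = expectation (\<lambda>x. w x * indicator B (X x)) / ?Z"
    by simp
  finally show ?thesis using Z by simp
qed

text \<open>At \<open>t = 0\<close> and phase 0 the hypothesis equates the two normalising
  constants; the tilted laws of \<open>X\<close> and \<open>Y\<close> then have the same
  characteristic function.\<close>

lemma positive_weighted_law_unique:
  fixes X w :: "'a \<Rightarrow> real" and Y v :: "'b \<Rightarrow> real"
  assumes M: "prob_space M" and N: "prob_space N"
    and [measurable]: "X \<in> borel_measurable M" "w \<in> borel_measurable M"
      "Y \<in> borel_measurable N" "v \<in> borel_measurable N" "B \<in> sets borel"
    and w: "\<And>x. 1 \<le> w x" "\<And>x. w x \<le> 3" and v: "\<And>x. 1 \<le> v x" "\<And>x. v x \<le> 3"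
    and eq: "\<And>t \<theta>. (\<integral>x. w x * cos (t * X x + \<theta>) \<partial>M) = (\<integral>x. v x * cos (t * Y x + \<theta>) \<partial>N)"
  shows "(\<integral>x. w x * indicator B (X x) \<partial>M) = (\<integral>x. v x * indicator B (Y x) \<partial>N)"
proof -
  interpret M: prob_space M by fact
  interpret N: prob_space N by fact
  have Z: "M.expectation w = N.expectation v" using eq[of 0 0] by simp
  let ?P = "distr (density M (\<lambda>x. w x / M.expectation w)) borel X"
  let ?Q = "distr (density N (\<lambda>x. v x / N.expectation v)) borel Y"
  have "?P = ?Q"
  proof (rule Levy_uniqueness)
    interpret P: prob_space "density M (\<lambda>x. w x / M.expectation w)"
      using w by (intro M.tilted_prob_space) auto
    interpret Q: prob_space "density N (\<lambda>x. v x / N.expectation v)"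
      using v by (intro N.tilted_prob_space) auto
    show "real_distribution ?P" by (rule P.real_distribution_distr) simp
    show "real_distribution ?Q" by (rule Q.real_distribution_distr) simp
    show "char ?P = char ?Q"
    proof
      fix t
      show "char ?P t = char ?Q t"
        unfolding M.char_tilted[OF assms(4) assms(3) w] N.char_tilted[OF assms(6) assms(5) v] eq
        by (simp add: Z)
    qed
  qed
  then show ?thesis
    using w v Z by (simp add: M.measure_tilted N.measure_tilted)
qed

text \<open>A signed weight is made positive by adding 2, and the unweighted identity
  \<open>eq1\<close> removes this constant again. Signed weights are needed because cosines will
  serve as weights.\<close>

lemma weighted_law_unique:
  fixes X w :: "'a \<Rightarrow> real" and Y v :: "'b \<Rightarrow> real"
  assumes M: "prob_space M" and N: "prob_space N"
    and [measurable]: "X \<in> borel_measurable M" "w \<in> borel_measurable M"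
      "Y \<in> borel_measurable N" "v \<in> borel_measurable N" "B \<in> sets borel"
    and w: "\<And>x. \<bar>w x\<bar> \<le> 1" and v: "\<And>x. \<bar>v x\<bar> \<le> 1"
    and eq1: "\<And>t \<theta>. (\<integral>x. cos (t * X x + \<theta>) \<partial>M) = (\<integral>x. cos (t * Y x + \<theta>) \<partial>N)"
    and eq: "\<And>t \<theta>. (\<integral>x. w x * cos (t * X x + \<theta>) \<partial>M) = (\<integral>x. v x * cos (t * Y x + \<theta>) \<partial>N)"
  shows "(\<integral>x. w x * indicator B (X x) \<partial>M) = (\<integral>x. v x * indicator B (Y x) \<partial>N)"
proof -
  interpret M: prob_space M by fact
  interpret N: prob_space N by fact
  have b: "\<bar>a * b\<bar> \<le> 1" if "\<bar>a\<bar> \<le> 1" "\<bar>b\<bar> \<le> 1" for a b :: real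
    using mult_mono[OF that] by (simp add: abs_mult)
  have [simp]: "integrable M (\<lambda>x. w x * cos (t * X x + \<theta>))" "integrable M (\<lambda>x. cos (t * X x + \<theta>))"
    "integrable M (\<lambda>x. w x * indicator B (X x))" "integrable M (\<lambda>x. indicator B (X x) :: real)" for t \<theta>
    using w by (auto intro!: M.integrable_bounded_by[where K = 1] b split: split_indicator)
  have [simp]: "integrable N (\<lambda>x. v x * cos (t * Y x + \<theta>))" "integrable N (\<lambda>x. cos (t * Y x + \<theta>))"
    "integrable N (\<lambda>x. v x * indicator B (Y x))" "integrable N (\<lambda>x. indicator B (Y x) :: real)" for t \<theta>
    using v by (auto intro!: N.integrable_bounded_by[where K = 1] b split: split_indicator)
  have w': "1 \<le> 2 + w x" "2 + w x \<le> 3" for x using w[of x] by auto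
  have v': "1 \<le> 2 + v x" "2 + v x \<le> 3" for x using v[of x] by auto
  have "(\<integral>x. (2 + w x) * indicator B (X x) \<partial>M) = (\<integral>x. (2 + v x) * indicator B (Y x) \<partial>N)"
    using w' v' by (intro positive_weighted_law_unique M N) (simp_all add: ring_distribs eq eq1)
  moreover have "(\<integral>x. (1::real) * indicator B (X x) \<partial>M) = (\<integral>x. 1 * indicator B (Y x) \<partial>N)"
    by (rule positive_weighted_law_unique[OF M N]) (simp_all add: eq1)
  ultimately show ?thesis
    by (simp add: ring_distribs)
qed

text \<open>Interpolates between characteristic functions (\<open>J\<close> empty) and rectangle
  probabilities (\<open>J = K\<close>). Each induction step turns one more coordinate from cosine
  into indicator; the indicators already present times the remaining cosine act as the weight, so
  one-dimensional uniqueness suffices.\<close>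

lemma joint_rectangles_unique:
  fixes X :: "'k \<Rightarrow> 'a \<Rightarrow> real" and Y :: "'k \<Rightarrow> 'b \<Rightarrow> real"
  assumes M: "prob_space M" and N: "prob_space N" and K: "finite K"
    and mX[measurable]: "\<And>l. l \<in> K \<Longrightarrow> X l \<in> borel_measurable M"
    and mY[measurable]: "\<And>l. l \<in> K \<Longrightarrow> Y l \<in> borel_measurable N"
    and eq: "\<And>t \<theta>. (\<integral>x. cos ((\<Sum>l\<in>K. t l * X l x) + \<theta>) \<partial>M) = (\<integral>x. cos ((\<Sum>l\<in>K. t l * Y l x) + \<theta>) \<partial>N)"
    and J: "finite J" "J \<subseteq> K" and mB[measurable]: "\<And>l. l \<in> J \<Longrightarrow> B l \<in> sets borel"
  shows "(\<integral>x. (\<Prod>l\<in>J. indicator (B l) (X l x)) * cos ((\<Sum>l\<in>K-J. t l * X l x) + \<theta>) \<partial>M)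
       = (\<integral>x. (\<Prod>l\<in>J. indicator (B l) (Y l x)) * cos ((\<Sum>l\<in>K-J. t l * Y l x) + \<theta>) \<partial>N)"
  using J mB
proof (induction J arbitrary: t \<theta> rule: finite_induct)
  case empty
  then show ?case using eq by simp
next
  case (insert j J)
  interpret M: prob_space M by fact
  interpret N: prob_space N by fact
  have jK: "j \<in> K" "J \<subseteq> K" using insert by auto
  note [measurable] = insert.prems(2) subsetD[OF jK(2)]
  have mj[measurable]: "X j \<in> borel_measurable M" "Y j \<in> borel_measurable N" "B j \<in> sets borel"
    using jK insert.prems by auto
  let ?PX = "\<lambda>x. (\<Prod>l\<in>J. indicator (B l) (X l x)) :: real"
  let ?PY = "\<lambda>x. (\<Prod>l\<in>J. indicator (B l) (Y l x)) :: real"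
  let ?SX = "\<lambda>t x. (\<Sum>l\<in>K-insert j J. t l * X l x)"
  let ?SY = "\<lambda>t x. (\<Sum>l\<in>K-insert j J. t l * Y l x)"
  have mPX[measurable]: "?PX \<in> borel_measurable M"
    using jK insert.prems by (intro borel_measurable_prod) (auto intro!: borel_measurable_indicator')
  have mPY[measurable]: "?PY \<in> borel_measurable N"
    using jK insert.prems by (intro borel_measurable_prod) (auto intro!: borel_measurable_indicator')
  have mS[measurable]: "?SX t \<in> borel_measurable M" "?SY t \<in> borel_measurable N" for t
    by (auto intro!: borel_measurable_sum)
  have P1: "\<bar>?PX x\<bar> \<le> 1" for x by (auto simp: abs_prod intro!: prod_le_1 split: split_indicator)
  have P2: "\<bar>?PY x\<bar> \<le> 1" for x by (auto simp: abs_prod intro!: prod_le_1 split: split_indicator)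
  have b: "\<bar>a * b\<bar> \<le> 1" if "\<bar>a\<bar> \<le> 1" "\<bar>b\<bar> \<le> 1" for a b :: real
    using mult_mono[OF that] by (simp add: abs_mult)
  have KJ: "K - J = insert j (K - insert j J)" using jK insert.hyps by auto
  have eqj: "(\<integral>x. ?PX x * cos (s * X j x + ?SX t x + \<theta>) \<partial>M)
    = (\<integral>x. ?PY x * cos (s * Y j x + ?SY t x + \<theta>) \<partial>N)" for s t \<theta>
  proof -
    have "(\<Sum>l\<in>K-J. (t(j := s)) l * X l x) = s * X j x + ?SX t x" for x
      unfolding KJ using K by (subst sum.insert) (auto intro!: sum.cong)
    moreover have "(\<Sum>l\<in>K-J. (t(j := s)) l * Y l x) = s * Y j x + ?SY t x" for x
      unfolding KJ using K by (subst sum.insert) (auto intro!: sum.cong)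
    ultimately show ?thesis
      using insert.IH[of "t(j := s)" \<theta>] insert.prems by simp
  qed
  \<comment> \<open>The weight contains a cosine of the remaining coordinates. Product-to-sum splits
    weight times test cosine into two single cosines, covered by the induction hypothesis with the
    coefficients \<open>t\<close> and \<open>- t\<close>.\<close>
  have prodcos: "cos (R + \<theta>) * cos (a + \<phi>) = (cos (a + R + (\<theta> + \<phi>)) + cos (a + - R + (\<phi> - \<theta>))) / 2" for R a \<theta> \<phi> :: real
    using cos_minus[of "R + \<theta> - (a + \<phi>)"] by (simp add: cos_times_cos algebra_simps)
  have "(\<integral>x. (?PX x * cos (?SX t x + \<theta>)) * indicator (B j) (X j x) \<partial>M)
      = (\<integral>x. (?PY x * cos (?SY t x + \<theta>)) * indicator (B j) (Y j x) \<partial>N)"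
  proof (rule weighted_law_unique[OF M N])
    fix s \<phi>
    show "(\<integral>x. cos (s * X j x + \<phi>) \<partial>M) = (\<integral>x. cos (s * Y j x + \<phi>) \<partial>N)"
      using eq[of "\<lambda>l. if l = j then s else 0" \<phi>] K jK by (simp add: if_distrib[of "\<lambda>t. t * _"] sum.delta cong: if_cong)
    have iM: "integrable M (\<lambda>x. ?PX x * cos (s * X j x + c * ?SX t x + \<theta>))" for c \<theta>
      using P1 by (intro M.integrable_bounded_by[where K = 1] b) auto
    have iN: "integrable N (\<lambda>x. ?PY x * cos (s * Y j x + c * ?SY t x + \<theta>))" for c \<theta>
      using P2 by (intro N.integrable_bounded_by[where K = 1] b) auto
    have "(\<integral>x. ?PX x * cos (?SX t x + \<theta>) * cos (s * X j x + \<phi>) \<partial>M)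
      = (\<integral>x. (?PX x * cos (s * X j x + 1 * ?SX t x + (\<theta> + \<phi>)) + ?PX x * cos (s * X j x + (-1) * ?SX t x + (\<phi> - \<theta>))) / 2 \<partial>M)"
      by (intro Bochner_Integration.integral_cong refl) (simp add: mult.assoc prodcos, simp add: field_simps)
    also have "\<dots> = ((\<integral>x. ?PX x * cos (s * X j x + 1 * ?SX t x + (\<theta> + \<phi>)) \<partial>M) + (\<integral>x. ?PX x * cos (s * X j x + (-1) * ?SX t x + (\<phi> - \<theta>)) \<partial>M)) / 2"
      by (simp only: Bochner_Integration.integral_add[OF iM iM] Bochner_Integration.integral_divide_zero)
    also have "\<dots> = ((\<integral>x. ?PY x * cos (s * Y j x + 1 * ?SY t x + (\<theta> + \<phi>)) \<partial>N) + (\<integral>x. ?PY x * cos (s * Y j x + (-1) * ?SY t x + (\<phi> - \<theta>)) \<partial>N)) / 2"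
      using eqj[of s t "\<theta> + \<phi>"] eqj[of s "\<lambda>l. - t l" "\<phi> - \<theta>"] by (simp add: sum_negf)
    also have "\<dots> = (\<integral>x. (?PY x * cos (s * Y j x + 1 * ?SY t x + (\<theta> + \<phi>)) + ?PY x * cos (s * Y j x + (-1) * ?SY t x + (\<phi> - \<theta>))) / 2 \<partial>N)"
      by (simp only: Bochner_Integration.integral_add[OF iN iN] Bochner_Integration.integral_divide_zero)
    also have "\<dots> = (\<integral>x. ?PY x * cos (?SY t x + \<theta>) * cos (s * Y j x + \<phi>) \<partial>N)"
      by (intro Bochner_Integration.integral_cong refl) (simp add: mult.assoc prodcos, simp add: field_simps)
    finally show "(\<integral>x. ?PX x * cos (?SX t x + \<theta>) * cos (s * X j x + \<phi>) \<partial>M) = (\<integral>x. ?PY x * cos (?SY t x + \<theta>) * cos (s * Y j x + \<phi>) \<partial>N)" .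
  qed (auto intro!: b P1 P2)
  then show ?case
    using insert.hyps by (simp add: mult_ac)
qed

text \<open>Uniqueness of multivariate characteristic functions: with every coordinate turned into
  an indicator, the measures agree on rectangles, which determine a finite product measure.\<close>

lemma joint_law_unique:
  fixes X :: "'k \<Rightarrow> 'a \<Rightarrow> real" and Y :: "'k \<Rightarrow> 'b \<Rightarrow> real"
  assumes M: "prob_space M" and N: "prob_space N" and K: "finite K"
    and mX[measurable]: "\<And>l. l \<in> K \<Longrightarrow> X l \<in> borel_measurable M"
    and mY[measurable]: "\<And>l. l \<in> K \<Longrightarrow> Y l \<in> borel_measurable N"
    and eq: "\<And>t \<theta>. (\<integral>x. cos ((\<Sum>l\<in>K. t l * X l x) + \<theta>) \<partial>M) = (\<integral>x. cos ((\<Sum>l\<in>K. t l * Y l x) + \<theta>) \<partial>N)"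
  shows "distr M (PiM K (\<lambda>_. borel)) (\<lambda>x. \<lambda>l\<in>K. X l x) = distr N (PiM K (\<lambda>_. borel)) (\<lambda>x. \<lambda>l\<in>K. Y l x)"
proof -
  interpret M: prob_space M by fact
  interpret N: prob_space N by fact
  have mX'[measurable]: "(\<lambda>x. \<lambda>l\<in>K. X l x) \<in> measurable M (PiM K (\<lambda>_. borel))"
    by (rule measurable_restrict) simp
  have mY'[measurable]: "(\<lambda>x. \<lambda>l\<in>K. Y l x) \<in> measurable N (PiM K (\<lambda>_. borel))"
    by (rule measurable_restrict) simp
  interpret P: prob_space "distr M (PiM K (\<lambda>_. borel)) (\<lambda>x. \<lambda>l\<in>K. X l x)"
    by (rule M.prob_space_distr) simp
  show ?thesis
  proof (rule measure_eqI_PiM_finite[where I = K and M = "\<lambda>_. borel" and A = "\<lambda>_. space (PiM K (\<lambda>_. borel))"])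
    show "range (\<lambda>_::nat. space (PiM K (\<lambda>_. borel))) \<subseteq> prod_algebra K (\<lambda>_. borel)"
      using space_in_prod_algebra[of K "\<lambda>_. borel"] by (auto simp: space_PiM)
    fix B :: "'k \<Rightarrow> real set" assume B: "\<And>i. i \<in> K \<Longrightarrow> B i \<in> sets borel"
    have S: "Pi\<^sub>E K B \<in> sets (PiM K (\<lambda>_. borel))" using B K by (intro sets_PiM_I_finite) auto
    have 1: "M.prob ((\<lambda>x. \<lambda>l\<in>K. X l x) -` Pi\<^sub>E K B \<inter> space M) = (\<integral>x. (\<Prod>l\<in>K. indicator (B l) (X l x)) \<partial>M)"
    proof -
      have "M.prob ((\<lambda>x. \<lambda>l\<in>K. X l x) -` Pi\<^sub>E K B \<inter> space M) = (\<integral>x. indicator ((\<lambda>x. \<lambda>l\<in>K. X l x) -` Pi\<^sub>E K B \<inter> space M) x \<partial>M)"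
        using S by simp
      also have "\<dots> = (\<integral>x. (\<Prod>l\<in>K. indicator (B l) (X l x)) \<partial>M)"
        using K by (intro Bochner_Integration.integral_cong refl)
          (auto simp: indicator_def PiE_iff prod_zero_iff intro!: prod.neutral[symmetric])
      finally show ?thesis .
    qed
    have 2: "N.prob ((\<lambda>x. \<lambda>l\<in>K. Y l x) -` Pi\<^sub>E K B \<inter> space N) = (\<integral>x. (\<Prod>l\<in>K. indicator (B l) (Y l x)) \<partial>N)"
    proof -
      have "N.prob ((\<lambda>x. \<lambda>l\<in>K. Y l x) -` Pi\<^sub>E K B \<inter> space N) = (\<integral>x. indicator ((\<lambda>x. \<lambda>l\<in>K. Y l x) -` Pi\<^sub>E K B \<inter> space N) x \<partial>N)"
        using S by simp
      also have "\<dots> = (\<integral>x. (\<Prod>l\<in>K. indicator (B l) (Y l x)) \<partial>N)"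
        using K by (intro Bochner_Integration.integral_cong refl)
          (auto simp: indicator_def PiE_iff prod_zero_iff intro!: prod.neutral[symmetric])
      finally show ?thesis .
    qed
    show "emeasure (distr M (PiM K (\<lambda>_. borel)) (\<lambda>x. \<lambda>l\<in>K. X l x)) (Pi\<^sub>E K B)
        = emeasure (distr N (PiM K (\<lambda>_. borel)) (\<lambda>x. \<lambda>l\<in>K. Y l x)) (Pi\<^sub>E K B)"
      using joint_rectangles_unique[where J = K and B = B and \<theta> = 0, OF M N K mX mY eq] B K S 1 2
      by (simp add: emeasure_distr M.emeasure_eq_measure N.emeasure_eq_measure)
  qed (use K in \<open>auto simp: P.emeasure_eq_measure\<close>)
qed

subsection \<open>Standard Gaussian vectors\<close>

definition std_gauss :: "'i set \<Rightarrow> ('i \<Rightarrow> real) measure" where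
  "std_gauss I = PiM I (\<lambda>_. std_normal_distribution)"

definition dot :: "'i set \<Rightarrow> ('i \<Rightarrow> real) \<Rightarrow> ('i \<Rightarrow> real) \<Rightarrow> real" where
  "dot I a b = (\<Sum>j\<in>I. a j * b j)"

lemma dot_commute: "dot I a b = dot I b a"
  by (simp add: dot_def mult.commute)

lemma dot_add_left: "dot I (\<lambda>j. a j + b j) c = dot I a c + dot I b c"
  by (simp add: dot_def algebra_simps sum.distrib)

lemma dot_diff_left: "dot I (\<lambda>j. a j - b j) c = dot I a c - dot I b c"
  by (simp add: dot_def algebra_simps sum_subtractf)

lemma dot_scale_left: "dot I (\<lambda>j. s * a j) c = s * dot I a c"
  by (simp add: dot_def algebra_simps sum_distrib_left)

lemma dot_minus_left: "dot I (\<lambda>j. - a j) c = - dot I a c"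
  by (simp add: dot_def sum_negf)

lemmas dot_left = dot_add_left dot_diff_left dot_scale_left dot_minus_left

lemma dot_right:
  "dot I c (\<lambda>j. a j + b j) = dot I c a + dot I c b"
  "dot I c (\<lambda>j. a j - b j) = dot I c a - dot I c b"
  "dot I c (\<lambda>j. s * a j) = s * dot I c a"
  "dot I c (\<lambda>j. - a j) = - dot I c a"
  by (simp_all add: dot_commute[of I c] dot_left)

lemma dot_cong: "(\<And>j. j \<in> I \<Longrightarrow> a j = a' j) \<Longrightarrow> (\<And>j. j \<in> I \<Longrightarrow> b j = b' j) \<Longrightarrow> dot I a b = dot I a' b'"
  by (simp add: dot_def)

lemma dot_self_nonneg: "0 \<le> dot I a a"
  by (simp add: dot_def sum_nonneg)

lemma dot_square_le: "(dot I a b)\<^sup>2 \<le> dot I a a * dot I b b"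
  using Cauchy_Schwarz_ineq_sum[of a b I] by (simp add: dot_def power2_eq_square)

lemma prob_space_std_normal: "prob_space std_normal_distribution"
  by (rule prob_space_normal_density) simp

lemma product_sigma_finite_std_normal: "product_sigma_finite (\<lambda>_. std_normal_distribution)"
  using prob_space_std_normal by (simp add: product_sigma_finite_def prob_space_imp_sigma_finite)

lemma prob_space_std_gauss: "prob_space (std_gauss I)"
  unfolding std_gauss_def by (intro prob_space_PiM prob_space_std_normal)

lemma sets_std_gauss[measurable_cong]: "sets (std_gauss I) = sets (PiM I (\<lambda>_. borel))"
  unfolding std_gauss_def by (intro sets_PiM_cong) auto

lemma space_std_gauss: "space (std_gauss I) = extensional I"
  by (simp add: std_gauss_def space_PiM PiE_UNIV_domain PiE_def)

lemma borel_measurable_dot[measurable (raw)]: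
  assumes "\<And>j. j \<in> I \<Longrightarrow> (\<lambda>x. f x j) \<in> borel_measurable M" "\<And>j. j \<in> I \<Longrightarrow> (\<lambda>x. h x j) \<in> borel_measurable M"
  shows "(\<lambda>x. dot I (f x) (h x)) \<in> borel_measurable M"
  unfolding dot_def using assms by (intro borel_measurable_sum borel_measurable_times) auto

lemma borel_measurable_dot_std_gauss[measurable]: "dot I a \<in> borel_measurable (std_gauss I)"
  by measurable

text \<open>The characteristic function factors over the coordinates; multiplying by
  \<open>iexp \<theta>\<close> before taking real parts introduces the phase.\<close>

lemma integral_cos_std_gauss:
  assumes I: "finite I"
  shows "(\<integral>g. cos (dot I a g + \<theta>) \<partial>std_gauss I) = cos \<theta> * exp (- dot I a a / 2)"
proof -
  interpret product_sigma_finite "\<lambda>_. std_normal_distribution"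
    by (rule product_sigma_finite_std_normal)
  interpret G: prob_space "std_gauss I" by (rule prob_space_std_gauss)
  interpret N: prob_space std_normal_distribution by (rule prob_space_std_normal)
  have "(CLINT g|std_gauss I. (\<Prod>j\<in>I. iexp (a j * g j))) = (\<Prod>j\<in>I. (CLINT x|std_normal_distribution. iexp (a j * x)))"
    unfolding std_gauss_def using I
    by (intro product_integral_prod N.integrable_const_bound[where B = 1]) auto
  also have "\<dots> = (\<Prod>j\<in>I. complex_of_real (exp (- (a j)\<^sup>2 / 2)))"
    using char_std_normal_distribution by (simp add: char_def fun_eq_iff)
  also have "\<dots> = complex_of_real (exp (- dot I a a / 2))"
    using I by (simp add: dot_def exp_sum[symmetric] sum_divide_distrib sum_negf power2_eq_square flip: of_real_prod)
  also have "(\<lambda>g. \<Prod>j\<in>I. iexp (a j * g j)) = (\<lambda>g. iexp (dot I a g))"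
    using I by (simp add: exp_sum[symmetric] dot_def sum_distrib_left)
  finally have char: "(CLINT g|std_gauss I. iexp (dot I a g)) = complex_of_real (exp (- dot I a a / 2))" .
  have int: "integrable (std_gauss I) (\<lambda>g. iexp \<theta> * iexp (dot I a g))"
    by (intro G.integrable_const_bound[where B = 1]) (auto simp: norm_mult)
  have "(\<integral>g. cos (dot I a g + \<theta>) \<partial>std_gauss I) = (\<integral>g. Re (iexp \<theta> * iexp (dot I a g)) \<partial>std_gauss I)"
    by (intro Bochner_Integration.integral_cong refl) (simp add: Re_exp Im_exp cos_add algebra_simps)
  also have "\<dots> = Re (CLINT g|std_gauss I. iexp \<theta> * iexp (dot I a g))"
    using int by (rule integral_Re)
  also have "\<dots> = cos \<theta> * exp (- dot I a a / 2)"
    by (simp add: char Re_exp)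
  finally show ?thesis .
qed

section \<open>Translations of Gaussian measure: the finite-dimensional Cameron-Martin
  formula\<close>

lemma nn_integral_std_normal_shift:
  assumes [measurable]: "A \<in> sets borel"
  shows "(\<integral>\<^sup>+ x. indicator A (x + c) \<partial>std_normal_distribution)
       = (\<integral>\<^sup>+ x. ennreal (exp (c * x - c\<^sup>2 / 2)) * indicator A x \<partial>std_normal_distribution)"
proof -
  have "(\<integral>\<^sup>+ x. indicator A (x + c) \<partial>std_normal_distribution) = (\<integral>\<^sup>+ x. ennreal (std_normal_density x) * indicator A (x + c) \<partial>lborel)"
    by (subst nn_integral_density) auto
  also have "\<dots> = (\<integral>\<^sup>+ x. ennreal (std_normal_density (x - c)) * indicator A x \<partial>lborel)"
    by (subst nn_integral_real_affine[where c = 1 and t = "- c"]) auto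
  also have "\<dots> = (\<integral>\<^sup>+ x. ennreal (std_normal_density x) * (ennreal (exp (c * x - c\<^sup>2 / 2)) * indicator A x) \<partial>lborel)"
  proof (intro nn_integral_cong)
    fix x :: real
    have "std_normal_density (x - c) = std_normal_density x * exp (c * x - c\<^sup>2 / 2)"
      by (simp add: std_normal_density_def exp_add[symmetric] power2_eq_square field_simps)
    then show "ennreal (std_normal_density (x - c)) * indicator A x
        = ennreal (std_normal_density x) * (ennreal (exp (c * x - c\<^sup>2 / 2)) * indicator A x)"
      by (simp add: ennreal_mult mult.assoc)
  qed
  also have "\<dots> = (\<integral>\<^sup>+ x. ennreal (exp (c * x - c\<^sup>2 / 2)) * indicator A x \<partial>std_normal_distribution)"
    by (subst nn_integral_density) auto
  finally show ?thesis .
qed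

lemma measurable_shift[measurable]: "(\<lambda>g. \<lambda>j\<in>I. g j + c j) \<in> measurable (std_gauss I) (PiM I (\<lambda>_. borel :: real measure))"
  by (rule measurable_restrict) simp

lemma distr_std_gauss_shift:
  assumes I: "finite I"
  shows "distr (std_gauss I) (PiM I (\<lambda>_. borel)) (\<lambda>g. \<lambda>j\<in>I. g j + c j)
       = density (std_gauss I) (\<lambda>g. ennreal (exp (dot I c g - dot I c c / 2)))" (is "?P = ?Q")
proof (rule measure_eqI_PiM_finite[where I = I and M = "\<lambda>_. borel" and A = "\<lambda>_. space (PiM I (\<lambda>_. borel))"])
  interpret product_sigma_finite "\<lambda>_. std_normal_distribution"
    by (rule product_sigma_finite_std_normal)
  interpret G: prob_space "std_gauss I" by (rule prob_space_std_gauss)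
  interpret P: prob_space ?P by (rule G.prob_space_distr) simp
  show "sets ?Q = sets (PiM I (\<lambda>_. borel))" by (simp add: sets_std_gauss)
  show "range (\<lambda>_::nat. space (PiM I (\<lambda>_. borel))) \<subseteq> prod_algebra I (\<lambda>_. borel)"
    using space_in_prod_algebra[of I "\<lambda>_. borel"] by (auto simp: space_PiM)
  show "?P (space (PiM I (\<lambda>_. borel))) \<noteq> \<infinity>" by (simp add: P.emeasure_eq_measure)
  fix A :: "'a \<Rightarrow> real set" assume A: "\<And>i. i \<in> I \<Longrightarrow> A i \<in> sets borel"
  have S: "Pi\<^sub>E I A \<in> sets (PiM I (\<lambda>_. borel))" using A I by (intro sets_PiM_I_finite) auto
  have S': "Pi\<^sub>E I A \<in> sets (std_gauss I)" using S by (simp add: sets_std_gauss)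
  have "?P (Pi\<^sub>E I A) = integral\<^sup>N ?P (indicator (Pi\<^sub>E I A))"
    using S by simp
  also have "\<dots> = (\<integral>\<^sup>+ g. indicator (Pi\<^sub>E I A) (\<lambda>j\<in>I. g j + c j) \<partial>std_gauss I)"
    using S by (subst nn_integral_distr) auto
  also have "\<dots> = (\<integral>\<^sup>+ g. (\<Prod>j\<in>I. indicator (A j) (g j + c j)) \<partial>std_gauss I)"
    using I by (intro nn_integral_cong) (auto simp: indicator_def PiE_iff prod_zero_iff intro!: prod.neutral[symmetric])
  also have "\<dots> = (\<Prod>j\<in>I. \<integral>\<^sup>+ x. indicator (A j) (x + c j) \<partial>std_normal_distribution)"
    unfolding std_gauss_def using I A by (intro product_nn_integral_prod) auto
  also have "\<dots> = (\<Prod>j\<in>I. \<integral>\<^sup>+ x. ennreal (exp (c j * x - (c j)\<^sup>2 / 2)) * indicator (A j) x \<partial>std_normal_distribution)"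
    using A by (intro prod.cong nn_integral_std_normal_shift) auto
  also have "\<dots> = (\<integral>\<^sup>+ g. (\<Prod>j\<in>I. ennreal (exp (c j * g j - (c j)\<^sup>2 / 2)) * indicator (A j) (g j)) \<partial>std_gauss I)"
    unfolding std_gauss_def using I A by (intro product_nn_integral_prod[symmetric]) auto
  also have "\<dots> = (\<integral>\<^sup>+ g. ennreal (exp (dot I c g - dot I c c / 2)) * indicator (Pi\<^sub>E I A) g \<partial>std_gauss I)"
  proof (intro nn_integral_cong)
    fix g assume "g \<in> space (std_gauss I)"
    then have g: "g \<in> extensional I" by (simp add: space_std_gauss)
    have "(\<Prod>j\<in>I. ennreal (exp (c j * g j - (c j)\<^sup>2 / 2))) = ennreal (exp (dot I c g - dot I c c / 2))"
      using I by (simp add: prod_ennreal exp_sum[symmetric] dot_def sum_subtractf sum_divide_distrib power2_eq_square)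
    moreover have "(\<Prod>j\<in>I. indicator (A j) (g j)) = (indicator (Pi\<^sub>E I A) g :: ennreal)"
      using I g by (auto simp: indicator_def PiE_iff prod_zero_iff intro!: prod.neutral)
    ultimately show "(\<Prod>j\<in>I. ennreal (exp (c j * g j - (c j)\<^sup>2 / 2)) * indicator (A j) (g j))
        = ennreal (exp (dot I c g - dot I c c / 2)) * indicator (Pi\<^sub>E I A) g"
      by (simp add: prod.distrib)
  qed
  also have "\<dots> = ?Q (Pi\<^sub>E I A)"
    using S' by (subst emeasure_density) auto
  finally show "?P (Pi\<^sub>E I A) = ?Q (Pi\<^sub>E I A)" .
qed (use I in auto)

lemma integral_std_gauss_shift:
  fixes F :: "('i \<Rightarrow> real) \<Rightarrow> real"
  assumes I: "finite I" and [measurable]: "F \<in> borel_measurable (PiM I (\<lambda>_. borel))"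
  shows "(\<integral>g. F (\<lambda>j\<in>I. g j + c j) \<partial>std_gauss I) = (\<integral>g. exp (dot I c g - dot I c c / 2) * F g \<partial>std_gauss I)"
proof -
  have "(\<integral>g. F (\<lambda>j\<in>I. g j + c j) \<partial>std_gauss I)
      = integral\<^sup>L (distr (std_gauss I) (PiM I (\<lambda>_. borel)) (\<lambda>g. \<lambda>j\<in>I. g j + c j)) F"
    by (subst integral_distr) auto
  also have "\<dots> = (\<integral>g. exp (dot I c g - dot I c c / 2) * F g \<partial>std_gauss I)"
    unfolding distr_std_gauss_shift[OF I] by (subst integral_density) auto
  finally show ?thesis .
qed

lemma exp_dot_std_gauss:
  assumes I: "finite I"
  shows "integrable (std_gauss I) (\<lambda>g. exp (dot I c g - dot I c c / 2))"
    and "(\<integral>g. exp (dot I c g - dot I c c / 2) \<partial>std_gauss I) = 1"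
proof -
  interpret G: prob_space "std_gauss I" by (rule prob_space_std_gauss)
  show 1: "(\<integral>g. exp (dot I c g - dot I c c / 2) \<partial>std_gauss I) = 1"
    using integral_std_gauss_shift[OF I, of "\<lambda>_. 1" c] by (simp add: G.prob_space)
  show "integrable (std_gauss I) (\<lambda>g. exp (dot I c g - dot I c c / 2))"
    \<comment> \<open>A non-integrable function has Bochner integral 0, so the value 1 already
      forces integrability.\<close>
    using 1 not_integrable_integral_eq by fastforce
qed

lemma std_gauss_eqI:
  fixes X :: "'i \<Rightarrow> 'a \<Rightarrow> real"
  assumes M: "prob_space M" and I: "finite I"
    and [measurable]: "\<And>j. j \<in> I \<Longrightarrow> X j \<in> borel_measurable M"
    and eq: "\<And>t \<theta>. (\<integral>x. cos ((\<Sum>j\<in>I. t j * X j x) + \<theta>) \<partial>M) = cos \<theta> * exp (- dot I t t / 2)"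
  shows "distr M (PiM I (\<lambda>_. borel)) (\<lambda>x. \<lambda>j\<in>I. X j x) = std_gauss I"
proof -
  have "distr M (PiM I (\<lambda>_. borel)) (\<lambda>x. \<lambda>j\<in>I. X j x)
      = distr (std_gauss I) (PiM I (\<lambda>_. borel)) (\<lambda>g. \<lambda>j\<in>I. g j)"
    using I eq integral_cos_std_gauss[OF I]
    by (intro joint_law_unique M prob_space_std_gauss) (simp_all add: dot_def)
  also have "\<dots> = std_gauss I"
    by (subst distr_cong[OF refl refl, where g = "\<lambda>x. x"])
      (auto simp: space_std_gauss extensional_restrict sets_std_gauss intro!: distr_id2)
  finally show ?thesis .
qed

section \<open>Laws of one and of two linear functionals of a Gaussian vector\<close>

lemma integral_cos_std_normal: "(\<integral>x. cos (t * x + \<theta>) \<partial>std_normal_distribution) = cos \<theta> * exp (- t\<^sup>2 / 2)"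
proof -
  interpret product_sigma_finite "\<lambda>_. std_normal_distribution"
    by (rule product_sigma_finite_std_normal)
  have "(\<integral>g. cos (dot {()} (\<lambda>_. t) g + \<theta>) \<partial>std_gauss {()}) = (\<integral>x. cos (t * x + \<theta>) \<partial>std_normal_distribution)"
    unfolding std_gauss_def dot_def
    using product_integral_singleton[of "\<lambda>x. cos (t * x + \<theta>)" "()"] by simp
  then show ?thesis
    using integral_cos_std_gauss[of "{()}" "\<lambda>_. t" \<theta>] by (simp add: dot_def power2_eq_square)
qed

lemma distr_dot_unit:
  assumes I: "finite I" and a: "dot I a a = 1"
  shows "distr (std_gauss I) borel (dot I a) = std_normal_distribution"
proof (rule measure_eqI)
  interpret G: prob_space "std_gauss I" by (rule prob_space_std_gauss)
  interpret N: prob_space std_normal_distribution by (rule prob_space_std_normal)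
  fix B assume "B \<in> sets (distr (std_gauss I) borel (dot I a))"
  then have [measurable]: "B \<in> sets borel" by simp
  have cos_dot: "(\<integral>g. cos (t * dot I a g + \<theta>) \<partial>std_gauss I) = cos \<theta> * exp (- t\<^sup>2 / 2)" for t \<theta>
    using integral_cos_std_gauss[OF I, of "\<lambda>j. t * a j" \<theta>] a by (simp add: dot_left dot_right power2_eq_square)
  note m = borel_measurable_dot_std_gauss[of I a]
  have "(\<integral>g. (1::real) * indicator B (dot I a g) \<partial>std_gauss I) = (\<integral>x. (1::real) * indicator B x \<partial>std_normal_distribution)"
    using I a by (intro positive_weighted_law_unique G.prob_space_axioms N.prob_space_axioms)
      (simp_all add: cos_dot integral_cos_std_normal)
  moreover have "(\<integral>g. (1::real) * indicator B (dot I a g) \<partial>std_gauss I) = G.prob (dot I a -` B \<inter> space (std_gauss I))"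
  proof -
    have "(\<integral>g. (1::real) * indicator B (dot I a g) \<partial>std_gauss I)
        = (\<integral>g. indicator (dot I a -` B \<inter> space (std_gauss I)) g \<partial>std_gauss I)"
      by (intro Bochner_Integration.integral_cong) (auto simp: indicator_def)
    then show ?thesis using m by simp
  qed
  ultimately show "emeasure (distr (std_gauss I) borel (dot I a)) B = emeasure std_normal_distribution B"
    using m by (simp add: emeasure_distr G.emeasure_eq_measure N.emeasure_eq_measure)
qed simp

text \<open>Excludes ties almost surely, so that the convention for the sign of 0 never
  matters.\<close>

lemma AE_dot_neq_0:
  assumes I: "finite I" and a: "dot I a a = 1"
  shows "AE g in std_gauss I. dot I a g \<noteq> 0"
proof -
  have "AE x in std_normal_distribution. x \<noteq> (0::real)"
    using AE_lborel_singleton[of "0::real"] by (subst AE_density) auto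
  then have "AE x in distr (std_gauss I) borel (dot I a). x \<noteq> 0"
    unfolding distr_dot_unit[OF assms] .
  then show ?thesis by (subst (asm) AE_distr_iff) auto
qed

lemma second_moment_dot_unit:
  assumes I: "finite I" and a: "dot I a a = 1"
  shows "integrable (std_gauss I) (\<lambda>g. (dot I a g)\<^sup>2)" "(\<integral>g. (dot I a g)\<^sup>2 \<partial>std_gauss I) = 1"
proof -
  note m = borel_measurable_dot_std_gauss[of I a]
  have 1: "(\<integral>x. x\<^sup>2 \<partial>std_normal_distribution) = 1"
    using std_normal_distribution_even_moments(1)[of 1] by simp
  have 2: "integrable std_normal_distribution (\<lambda>x. x\<^sup>2)"
    using std_normal_distribution_even_moments(2)[of 1] by simp
  show "(\<integral>g. (dot I a g)\<^sup>2 \<partial>std_gauss I) = 1"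
    using 1 m unfolding distr_dot_unit[OF assms, symmetric] by (subst (asm) integral_distr) auto
  show "integrable (std_gauss I) (\<lambda>g. (dot I a g)\<^sup>2)"
    using 2 m unfolding distr_dot_unit[OF assms, symmetric] by (subst (asm) integrable_distr_eq) auto
qed

text \<open>The joint characteristic function of two linear functionals involves only their Gram
  matrix. The index sets may differ, which later moves every computation with a single pair into the
  plane.\<close>

lemma integral_dot_pair_cong:
  fixes f :: "real \<Rightarrow> real \<Rightarrow> real"
  assumes I: "finite I" and J: "finite J"
    and gram: "dot I a a = dot J a' a'" "dot I a b = dot J a' b'" "dot I b b = dot J b' b'"
    and [measurable]: "case_prod f \<in> borel_measurable (borel \<Otimes>\<^sub>M borel)"
  shows "(\<integral>g. f (dot I a g) (dot I b g) \<partial>std_gauss I) = (\<integral>g. f (dot J a' g) (dot J b' g) \<partial>std_gauss J)"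
proof -
  let ?P = "PiM (UNIV :: bool set) (\<lambda>_. borel :: real measure)"
  let ?X = "\<lambda>g. \<lambda>l\<in>UNIV. dot I (if l then a else b) g"
  let ?Y = "\<lambda>g. \<lambda>l\<in>UNIV. dot J (if l then a' else b') g"
  have [measurable]: "?X \<in> measurable (std_gauss I) ?P" "?Y \<in> measurable (std_gauss J) ?P"
    by (auto intro!: measurable_restrict)
  have sX: "(\<Sum>l\<in>UNIV. t l * dot I (if l then a else b) g)
      = dot I (\<lambda>j. t True * a j + t False * b j) g" for t g
    by (simp add: UNIV_bool dot_left)
  have sY: "(\<Sum>l\<in>UNIV. t l * dot J (if l then a' else b') g)
      = dot J (\<lambda>j. t True * a' j + t False * b' j) g" for t g
    by (simp add: UNIV_bool dot_left)
  have eq: "distr (std_gauss I) ?P ?X = distr (std_gauss J) ?P ?Y"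
  proof (rule joint_law_unique)
    fix t \<theta>
    show "(\<integral>x. cos ((\<Sum>l\<in>UNIV. t l * dot I (if l then a else b) x) + \<theta>) \<partial>std_gauss I)
        = (\<integral>x. cos ((\<Sum>l\<in>UNIV. t l * dot J (if l then a' else b') x) + \<theta>) \<partial>std_gauss J)"
      unfolding sX sY integral_cos_std_gauss[OF I] integral_cos_std_gauss[OF J]
      using gram by (simp add: dot_left dot_right dot_commute[of I b a] dot_commute[of J b' a'])
  qed (auto intro!: prob_space_std_gauss)
  have [measurable]: "(\<lambda>z. f (z True) (z False)) \<in> borel_measurable ?P" by measurable
  have "(\<integral>g. f (dot I a g) (dot I b g) \<partial>std_gauss I) = (\<integral>z. f (z True) (z False) \<partial>distr (std_gauss I) ?P ?X)"
    by (subst integral_distr) auto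
  also have "\<dots> = (\<integral>g. f (dot J a' g) (dot J b' g) \<partial>std_gauss J)"
    unfolding eq by (subst integral_distr) auto
  finally show ?thesis .
qed

section \<open>Symmetry of the Gaussian law and translations of even functions\<close>

lemma distr_std_gauss_minus:
  assumes I: "finite I"
  shows "distr (std_gauss I) (PiM I (\<lambda>_. borel)) (\<lambda>g. \<lambda>j\<in>I. - g j) = std_gauss I"
proof (rule std_gauss_eqI[OF prob_space_std_gauss I])
  fix t \<theta>
  have "(\<Sum>j\<in>I. t j * - g j) = dot I (\<lambda>j. - t j) g" for g by (simp add: dot_def)
  then show "(\<integral>g. cos ((\<Sum>j\<in>I. t j * - g j) + \<theta>) \<partial>std_gauss I) = cos \<theta> * exp (- dot I t t / 2)"
    using integral_cos_std_gauss[OF I, of "\<lambda>j. - t j" \<theta>]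
    by (simp only:) (simp add: dot_left dot_right)
qed simp

text \<open>The two exponential tilts coming from the shifts by \<open>c\<close> and \<open>- c\<close> average to
  \<open>exp (- dot I c c / 2) * cosh (dot I c g)\<close>, so that the first-order term cancels.\<close>

lemma even_shift_bound:
  fixes F :: "('i \<Rightarrow> real) \<Rightarrow> real"
  assumes I: "finite I" and [measurable]: "F \<in> borel_measurable (PiM I (\<lambda>_. borel))"
    and F: "\<And>g. 0 \<le> F g" "\<And>g. F g \<le> 1" and even: "\<And>g. g \<in> extensional I \<Longrightarrow> F (\<lambda>j\<in>I. - g j) = F g"
  shows "\<bar>(\<integral>g. F (\<lambda>j\<in>I. g j + c j) \<partial>std_gauss I) - (\<integral>g. F g \<partial>std_gauss I)\<bar> \<le> dot I c c"
proof -
  interpret G: prob_space "std_gauss I" by (rule prob_space_std_gauss)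
  define e where "e = (\<lambda>s g. exp (dot I (\<lambda>j. s * c j) g - dot I c c / 2))"
  have e: "integrable (std_gauss I) (e s)" "(\<integral>g. e s g \<partial>std_gauss I) = 1" if "s\<^sup>2 = 1" for s
    using exp_dot_std_gauss[OF I, of "\<lambda>j. s * c j"] that
    by (simp_all add: e_def dot_left dot_right power2_eq_square mult.assoc[symmetric])
  have [measurable]: "e s \<in> borel_measurable (PiM I (\<lambda>_. borel))" for s unfolding e_def by measurable
  have iF: "integrable (std_gauss I) F"
    using F by (intro G.integrable_bounded_by[where K = 1]) (auto simp: abs_le_iff intro: order_trans[of _ 0])
  have ieF: "integrable (std_gauss I) (\<lambda>g. e s g * F g)" if "s\<^sup>2 = 1" for s
  proof (rule Bochner_Integration.integrable_bound[OF e(1)[OF that]])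
    show "AE g in std_gauss I. norm (e s g * F g) \<le> norm (e s g)"
      using F by (auto simp: abs_mult intro!: mult_left_le)
  qed simp
  have plus: "(\<integral>g. F (\<lambda>j\<in>I. g j + c j) \<partial>std_gauss I) = (\<integral>g. e 1 g * F g \<partial>std_gauss I)"
    unfolding e_def using integral_std_gauss_shift[OF I, of F c] by simp
  have [measurable]: "(\<lambda>g. \<lambda>j\<in>I. - g j) \<in> measurable (std_gauss I) (PiM I (\<lambda>_. borel))"
    by (auto intro!: measurable_restrict)
  \<comment> \<open>Reflecting the Gaussian vector exchanges the densities of the shifts by
    \<open>c\<close> and \<open>- c\<close>, while \<open>F\<close> is unchanged by evenness; hence
    \<open>F\<close> may be integrated against their average \<open>w\<close>.\<close>
  have "(\<integral>g. e 1 g * F g \<partial>std_gauss I) = (\<integral>g. e 1 g * F g \<partial>distr (std_gauss I) (PiM I (\<lambda>_. borel)) (\<lambda>g. \<lambda>j\<in>I. - g j))"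
    unfolding distr_std_gauss_minus[OF I] ..
  also have "\<dots> = (\<integral>g. e 1 (\<lambda>j\<in>I. - g j) * F (\<lambda>j\<in>I. - g j) \<partial>std_gauss I)"
    by (subst integral_distr) auto
  also have "\<dots> = (\<integral>g. e (-1) g * F g \<partial>std_gauss I)"
    by (intro Bochner_Integration.integral_cong)
      (auto simp: even space_std_gauss e_def dot_def sum_negf)
  finally have flip: "(\<integral>g. e 1 g * F g \<partial>std_gauss I) = (\<integral>g. e (-1) g * F g \<partial>std_gauss I)" .
  define w where "w = (\<lambda>g. (e 1 g + e (-1) g) / 2)"
  have w: "integrable (std_gauss I) w" "(\<integral>g. w g \<partial>std_gauss I) = 1"
    unfolding w_def using e[of 1] e[of "-1"] by auto
  have "(\<integral>g. F (\<lambda>j\<in>I. g j + c j) \<partial>std_gauss I) = (\<integral>g. (e 1 g * F g + e (-1) g * F g) / 2 \<partial>std_gauss I)"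
    using plus flip ieF[of 1] ieF[of "-1"] by simp
  also have "\<dots> = (\<integral>g. w g * F g \<partial>std_gauss I)"
    by (intro Bochner_Integration.integral_cong) (auto simp: w_def algebra_simps add_divide_distrib)
  finally have 1: "(\<integral>g. F (\<lambda>j\<in>I. g j + c j) \<partial>std_gauss I) = (\<integral>g. w g * F g \<partial>std_gauss I)" .
  have iwF: "integrable (std_gauss I) (\<lambda>g. w g * F g)"
    using ieF[of 1] ieF[of "-1"] by (simp add: w_def algebra_simps add_divide_distrib)
  \<comment> \<open>As cosh is at least 1, \<open>r\<close> bounds both \<open>w\<close> and 1 from
    below, so the distance of \<open>w\<close> from 1 is at most \<open>(1 - r) + (w g - r)\<close>.
    Since \<open>w\<close> has mean 1, this integrates to \<open>2 * (1 - r)\<close>, which is at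
    most \<open>dot I c c\<close>.\<close>
  define r where "r = exp (- dot I c c / 2)"
  have r: "r \<le> 1" "1 - dot I c c / 2 \<le> r"
    using dot_self_nonneg[of I c] exp_ge_add_one_self[of "- dot I c c / 2"] by (auto simp: r_def)
  have er: "e s g = r * exp (s * dot I c g)" for s g
    by (simp add: e_def r_def dot_left flip: exp_add)
  have wr: "r \<le> w g" for g
  proof -
    have "2 \<le> exp (dot I c g) + exp (- dot I c g)"
      using exp_ge_add_one_self[of "dot I c g"] exp_ge_add_one_self[of "- dot I c g"] by linarith
    then have "r * 1 \<le> r * ((exp (dot I c g) + exp (- dot I c g)) / 2)"
      by (intro mult_left_mono) (simp_all add: r_def)
    also have "\<dots> = w g"
      using er[of 1 g] er[of "-1" g] by (simp add: w_def algebra_simps add_divide_distrib)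
    finally show ?thesis by simp
  qed
  have "\<bar>(\<integral>g. w g * F g \<partial>std_gauss I) - (\<integral>g. F g \<partial>std_gauss I)\<bar> = \<bar>\<integral>g. w g * F g - F g \<partial>std_gauss I\<bar>"
    using iwF iF by simp
  also have "\<dots> \<le> (\<integral>g. (1 - r) + (w g - r) \<partial>std_gauss I)"
  proof (rule integral_abs_bound[THEN order_trans], rule integral_mono)
    show "integrable (std_gauss I) (\<lambda>g. \<bar>w g * F g - F g\<bar>)" using iwF iF by auto
    show "integrable (std_gauss I) (\<lambda>g. (1 - r) + (w g - r))" using w by auto
    fix g
    have "\<bar>w g * F g - F g\<bar> = \<bar>w g - 1\<bar> * F g"
      using F(1)[of g] abs_mult[of "w g - 1" "F g"] by (simp add: left_diff_distrib)
    also have "\<dots> \<le> \<bar>w g - 1\<bar>" using F[of g] by (simp add: mult_left_le)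
    also have "\<dots> \<le> (1 - r) + (w g - r)" using wr[of g] r by auto
    finally show "\<bar>w g * F g - F g\<bar> \<le> (1 - r) + (w g - r)" .
  qed
  also have "\<dots> = 2 * (1 - r)" using w by (simp add: G.prob_space)
  also have "\<dots> \<le> dot I c c" using r by auto
  finally show ?thesis using 1 by simp
qed

subsection \<open>Covariances of even functions of Gaussian pairs\<close>

lemma dot_restrict_right: "dot I a (\<lambda>j\<in>I. b j) = dot I a b"
  by (rule dot_cong) auto

text \<open>Any \<open>c\<close> with the prescribed inner products realises the shift of the pair
  by \<open>(b1, b2)\<close>; the price is the squared length of the chosen
  \<open>c\<close>.\<close>

lemma even_linear_shift_bound:
  fixes f :: "real \<Rightarrow> real \<Rightarrow> real"
  assumes I: "finite I" and [measurable]: "case_prod f \<in> borel_measurable (borel \<Otimes>\<^sub>M borel)"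
    and f: "\<And>x y. 0 \<le> f x y" "\<And>x y. f x y \<le> 1" and even: "\<And>x y. f (- x) (- y) = f x y"
    and c: "dot I w1 c = b1" "dot I w2 c = b2"
  shows "\<bar>(\<integral>g. f (b1 + dot I w1 g) (b2 + dot I w2 g) \<partial>std_gauss I) - (\<integral>g. f (dot I w1 g) (dot I w2 g) \<partial>std_gauss I)\<bar> \<le> dot I c c"
proof -
  have "\<bar>(\<integral>g. f (dot I w1 (\<lambda>j\<in>I. g j + c j)) (dot I w2 (\<lambda>j\<in>I. g j + c j)) \<partial>std_gauss I)
      - (\<integral>g. f (dot I w1 g) (dot I w2 g) \<partial>std_gauss I)\<bar> \<le> dot I c c"
    using f by (intro even_shift_bound I) (auto simp: even dot_restrict_right dot_right)
  then show ?thesis by (simp add: dot_restrict_right dot_right c add.commute)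
qed

text \<open>\<open>P\<close> is the orthogonal projection onto the span of \<open>u1\<close> and
  \<open>u2\<close>. Orthogonal components of a Gaussian vector are independent, so the
  complementary component may be taken from an independent copy.\<close>

lemma distr_std_gauss_resample:
  assumes I: "finite I" and u: "dot I u1 u1 = 1" "dot I u2 u2 = 1" "dot I u1 u2 = 0"
  defines "P \<equiv> \<lambda>g j. dot I u1 g * u1 j + dot I u2 g * u2 j"
  shows "distr (std_gauss I \<Otimes>\<^sub>M std_gauss I) (PiM I (\<lambda>_. borel)) (\<lambda>x. \<lambda>j\<in>I. P (fst x) j + (snd x j - P (snd x) j)) = std_gauss I"
proof (rule std_gauss_eqI[OF _ I])
  interpret G: prob_space "std_gauss I" by (rule prob_space_std_gauss)
  interpret GG: pair_prob_space "std_gauss I" "std_gauss I" ..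
  show "prob_space (std_gauss I \<Otimes>\<^sub>M std_gauss I)" by unfold_locales
  have u': "dot I u2 u1 = 0" using u by (simp add: dot_commute)
  fix t \<theta>
  define s where "s = (\<lambda>j. t j - P t j)"
  have P_right: "dot I c (P g) = dot I u1 g * dot I c u1 + dot I u2 g * dot I c u2" for c g
    unfolding P_def by (simp add: dot_right)
  have P_left: "dot I (P g) c = dot I u1 g * dot I c u1 + dot I u2 g * dot I c u2" for c g
    using P_right by (simp add: dot_commute)
  have eq: "(\<Sum>j\<in>I. t j * (P (fst x) j + (snd x j - P (snd x) j))) = dot I s (snd x) + dot I (P t) (fst x)" for x
  proof -
    have "(\<Sum>j\<in>I. t j * (P (fst x) j + (snd x j - P (snd x) j))) = dot I t (\<lambda>j. P (fst x) j + (snd x j - P (snd x) j))"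
      by (simp add: dot_def)
    also have "\<dots> = dot I t (P (fst x)) + (dot I t (snd x) - dot I t (P (snd x)))"
      by (simp add: dot_right)
    also have "\<dots> = dot I s (snd x) + dot I (P t) (fst x)"
      by (simp add: s_def dot_left P_right P_left dot_commute[of I t u1] dot_commute[of I t u2]
          dot_commute[of I "fst x"] dot_commute[of I "snd x"])
    finally show ?thesis .
  qed
  \<comment> \<open>Pythagoras for the decomposition of \<open>t\<close> into \<open>P t\<close> and
    \<open>s\<close>: the exponents contributed by the two independent copies add up to that of
    \<open>t\<close>.\<close>
  have pyth: "dot I s s + dot I (P t) (P t) = dot I t t"
    by (simp add: s_def dot_left dot_right P_right P_left dot_commute[of I t u1] dot_commute[of I t u2] u u' algebra_simps)
  have "(\<integral>x. cos (dot I s (snd x) + (dot I (P t) (fst x) + \<theta>)) \<partial>(std_gauss I \<Otimes>\<^sub>M std_gauss I))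
     = (\<integral>g'. (\<integral>g. cos (dot I s g + (dot I (P t) g' + \<theta>)) \<partial>std_gauss I) \<partial>std_gauss I)"
    by (subst GG.integral_fst'[symmetric]) (auto intro!: GG.integrable_bounded_by[where K = 1])
  also have "\<dots> = cos \<theta> * exp (- dot I t t / 2)"
    unfolding integral_cos_std_gauss[OF I]
    using integral_cos_std_gauss[OF I, of "P t" \<theta>] pyth
    by (simp add: mult.assoc exp_add[symmetric] add_divide_distrib[symmetric])
  finally show "(\<integral>x. cos ((\<Sum>j\<in>I. t j * (P (fst x) j + (snd x j - P (snd x) j))) + \<theta>) \<partial>(std_gauss I \<Otimes>\<^sub>M std_gauss I))
      = cos \<theta> * exp (- dot I t t / 2)"
    unfolding eq by (simp add: add.assoc)
qed (simp add: P_def)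

text \<open>With \<open>Q\<close> the matrix with rows \<open>(a, b)\<close> and
  \<open>(c, d)\<close>, the system reads \<open>(1 - Q^T Q) \<beta> = Q^T y\<close>, and
  \<open>m\<close> is the squared Frobenius norm of \<open>Q\<close>. In the application
  \<open>Q\<close> holds the correlations between two orthonormal pairs and \<open>\<beta>\<close>
  the coefficients of the translation. For \<open>m\<close> at most 1/2 the determinant
  \<open>D\<close> is at least 1/2, and Cramer's rule gives the solution.\<close>

lemma small_perturbation_solvable:
  fixes a b c d y1 y2 :: real
  defines "m \<equiv> a\<^sup>2 + b\<^sup>2 + c\<^sup>2 + d\<^sup>2"
  assumes m: "m \<le> 1/2"
  obtains \<beta>1 \<beta>2 where
    "\<beta>1 - (a * (a * \<beta>1 + b * \<beta>2) + c * (c * \<beta>1 + d * \<beta>2)) = a * y1 + c * y2"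
    "\<beta>2 - (b * (a * \<beta>1 + b * \<beta>2) + d * (c * \<beta>1 + d * \<beta>2)) = b * y1 + d * y2"
    "\<beta>1\<^sup>2 + \<beta>2\<^sup>2 \<le> 4 * m * (y1\<^sup>2 + y2\<^sup>2)"
proof -
  define A where "A = a\<^sup>2 + c\<^sup>2"
  define B where "B = a * b + c * d"
  define E where "E = b\<^sup>2 + d\<^sup>2"
  define r1 where "r1 = a * y1 + c * y2"
  define r2 where "r2 = b * y1 + d * y2"
  define D where "D = (1 - A) * (1 - E) - B\<^sup>2"
  have "A * E - B\<^sup>2 = (a * d - b * c)\<^sup>2" by (simp add: A_def B_def E_def power2_eq_square algebra_simps)
  then have "A * E - B\<^sup>2 \<ge> 0" by simp
  then have D: "D \<ge> 1/2" using m by (simp add: D_def m_def A_def E_def algebra_simps)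
  define \<beta>1 where "\<beta>1 = ((1 - E) * r1 + B * r2) / D"
  define \<beta>2 where "\<beta>2 = (B * r1 + (1 - A) * r2) / D"
  have 1: "(1 - A) * \<beta>1 - B * \<beta>2 = r1"
  proof -
    have "(1 - A) * \<beta>1 - B * \<beta>2 = ((1 - A) * ((1 - E) * r1 + B * r2) - B * (B * r1 + (1 - A) * r2)) / D"
      by (simp add: \<beta>1_def \<beta>2_def diff_divide_distrib)
    also have "\<dots> = (D * r1) / D" by (simp add: D_def power2_eq_square algebra_simps)
    finally show ?thesis using D by simp
  qed
  have 2: "(1 - E) * \<beta>2 - B * \<beta>1 = r2"
  proof -
    have "(1 - E) * \<beta>2 - B * \<beta>1 = ((1 - E) * (B * r1 + (1 - A) * r2) - B * ((1 - E) * r1 + B * r2)) / D"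
      by (simp add: \<beta>1_def \<beta>2_def diff_divide_distrib)
    also have "\<dots> = (D * r2) / D" by (simp add: D_def power2_eq_square algebra_simps)
    finally show ?thesis using D by simp
  qed
  let ?N = "\<beta>1\<^sup>2 + \<beta>2\<^sup>2"
  let ?Y = "y1\<^sup>2 + y2\<^sup>2"
  \<comment> \<open>The system paired with \<open>\<beta>\<close>: its squared length is the inner
    product with the right-hand side plus the squared length of \<open>Q \<beta>\<close>. The latter
    is at most half of the total, and a weighted arithmetic-geometric inequality absorbs another
    quarter, whence the factor 4.\<close>
  have N: "?N = (r1 * \<beta>1 + r2 * \<beta>2) + ((a * \<beta>1 + b * \<beta>2)\<^sup>2 + (c * \<beta>1 + d * \<beta>2)\<^sup>2)"
    unfolding 1[symmetric] 2[symmetric] by (simp add: A_def B_def E_def power2_eq_square algebra_simps)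
  have cs: "(x * p + y * q)\<^sup>2 \<le> (x\<^sup>2 + y\<^sup>2) * (p\<^sup>2 + q\<^sup>2)" for x y p q :: real
  proof -
    have "(x\<^sup>2 + y\<^sup>2) * (p\<^sup>2 + q\<^sup>2) - (x * p + y * q)\<^sup>2 = (x * q - y * p)\<^sup>2"
      by (simp add: power2_eq_square algebra_simps)
    then show ?thesis using zero_le_power2[of "x * q - y * p"] by linarith
  qed
  have half: "n / 2 \<le> s" if "T \<le> 1/2 * n" "n = s + T" for n s T :: real
    using that by linarith
  have quarter: "n \<le> 4 * s" if "n / 2 \<le> s + n / 4" for n s :: real
    using that by linarith
  have "(a * \<beta>1 + b * \<beta>2)\<^sup>2 + (c * \<beta>1 + d * \<beta>2)\<^sup>2 \<le> m * ?N"
    using cs[of a \<beta>1 b \<beta>2] cs[of c \<beta>1 d \<beta>2] by (simp add: m_def algebra_simps)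
  also have "\<dots> \<le> 1/2 * ?N" using m by (intro mult_right_mono) auto
  finally have "?N / 2 \<le> r1 * \<beta>1 + r2 * \<beta>2"
    using N half[of "(a * \<beta>1 + b * \<beta>2)\<^sup>2 + (c * \<beta>1 + d * \<beta>2)\<^sup>2"] by blast
  also have "\<dots> \<le> (r1\<^sup>2 + r2\<^sup>2) + ?N / 4"
    using zero_le_power2[of "r1 - \<beta>1 / 2"] zero_le_power2[of "r2 - \<beta>2 / 2"]
    by (simp add: power2_eq_square algebra_simps add_divide_distrib)
  finally have "?N \<le> 4 * (r1\<^sup>2 + r2\<^sup>2)" by (rule quarter)
  also have "\<dots> \<le> 4 * (m * ?Y)"
    using cs[of a y1 c y2] cs[of b y1 d y2] by (simp add: r1_def r2_def m_def algebra_simps)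
  finally have 3: "?N \<le> 4 * m * ?Y" by simp
  show thesis
  proof (rule that[OF _ _ 3])
    show "\<beta>1 - (a * (a * \<beta>1 + b * \<beta>2) + c * (c * \<beta>1 + d * \<beta>2)) = a * y1 + c * y2"
      using 1 by (simp add: A_def B_def r1_def power2_eq_square algebra_simps)
    show "\<beta>2 - (b * (a * \<beta>1 + b * \<beta>2) + d * (c * \<beta>1 + d * \<beta>2)) = b * y1 + d * y2"
      using 2 by (simp add: E_def B_def r2_def power2_eq_square algebra_simps)
  qed
qed

text \<open>Evenness is what makes the bound quadratic in the correlations, rather than linear.\<close>

lemma covariance_even_bound:
  fixes f :: "real \<Rightarrow> real \<Rightarrow> real"
  assumes I: "finite I" and [measurable]: "case_prod f \<in> borel_measurable (borel \<Otimes>\<^sub>M borel)"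
    and f: "\<And>x y. 0 \<le> f x y" "\<And>x y. f x y \<le> 1" and even: "\<And>x y. f (- x) (- y) = f x y"
    and u: "dot I u1 u1 = 1" "dot I u2 u2 = 1" "dot I u1 u2 = 0"
    and v: "dot I v1 v1 = 1" "dot I v2 v2 = 1" "dot I v1 v2 = 0"
  defines "m \<equiv> (dot I u1 v1)\<^sup>2 + (dot I u1 v2)\<^sup>2 + (dot I u2 v1)\<^sup>2 + (dot I u2 v2)\<^sup>2"
  shows "\<bar>(\<integral>g. f (dot I u1 g) (dot I u2 g) * f (dot I v1 g) (dot I v2 g) \<partial>std_gauss I)
    - (\<integral>g. f (dot I u1 g) (dot I u2 g) \<partial>std_gauss I) * (\<integral>g. f (dot I v1 g) (dot I v2 g) \<partial>std_gauss I)\<bar> \<le> 16 * m"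
proof -
  interpret G: prob_space "std_gauss I" by (rule prob_space_std_gauss)
  interpret GG: pair_prob_space "std_gauss I" "std_gauss I" ..
  define \<phi> where "\<phi> = (\<lambda>g. f (dot I u1 g) (dot I u2 g))"
  define \<psi> where "\<psi> = (\<lambda>g. f (dot I v1 g) (dot I v2 g))"
  have [measurable]: "\<phi> \<in> borel_measurable (PiM I (\<lambda>_. borel))" "\<psi> \<in> borel_measurable (PiM I (\<lambda>_. borel))"
    by (simp_all add: \<phi>_def \<psi>_def)
  have \<phi>: "0 \<le> \<phi> g" "\<phi> g \<le> 1" and \<psi>: "0 \<le> \<psi> g" "\<psi> g \<le> 1" for g
    using f by (auto simp: \<phi>_def \<psi>_def)
  have bnd: "0 \<le> a * b" "a * b \<le> 1" "\<bar>a * b\<bar> \<le> 1" if "0 \<le> a" "a \<le> 1" "0 \<le> b" "b \<le> 1" for a b :: real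
    using that mult_le_one[of a b] by auto
  have [simp]: "integrable (std_gauss I) \<phi>" "integrable (std_gauss I) \<psi>" "integrable (std_gauss I) (\<lambda>g. \<phi> g * \<psi> g)"
    using \<phi> \<psi> by (auto intro!: G.integrable_bounded_by[where K = 1] bnd simp: abs_le_iff intro: order_trans[of _ 0])
  let ?E = "\<lambda>h. \<integral>g. h g \<partial>std_gauss I"
  have E: "0 \<le> ?E \<phi>" "?E \<phi> \<le> 1" "0 \<le> ?E \<psi>" "?E \<psi> \<le> 1" "0 \<le> ?E (\<lambda>g. \<phi> g * \<psi> g)" "?E (\<lambda>g. \<phi> g * \<psi> g) \<le> 1"
    using \<phi> \<psi> by (auto intro!: integral_nonneg_AE AE_I2 G.integral_le_const bnd)
  show ?thesis
  proof (cases "m \<le> 1/2")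
    case False
    \<comment> \<open>For large correlations the claim is trivial, the covariance of functions with
      values in [0, 1] being at most 1 in absolute value.\<close>
    then have "1 \<le> 16 * m" by simp
    then have "\<bar>?E (\<lambda>g. \<phi> g * \<psi> g) - ?E \<phi> * ?E \<psi>\<bar> \<le> 16 * m"
      using E bnd(1,2)[of "?E \<phi>" "?E \<psi>"] by linarith
    then show ?thesis by (simp add: \<phi>_def \<psi>_def)
  next
    case True
    \<comment> \<open>\<open>b1\<close> and \<open>b2\<close> are the conditional means of the
      \<open>v\<close>-pair given the \<open>u\<close>-pair; \<open>w1\<close> and \<open>w2\<close>
      are the components of \<open>v1\<close> and \<open>v2\<close> orthogonal to \<open>u1\<close>
      and \<open>u2\<close>. \<open>X\<close> keeps the projection of one Gaussian vector and
      resamples the rest, so \<open>H\<close> is the conditional expectation of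
      \<open>\<psi>\<close> and \<open>H0\<close> its value without the shift.\<close>
    define P where "P = (\<lambda>g j. dot I u1 g * u1 j + dot I u2 g * u2 j)"
    define w1 where "w1 = (\<lambda>j. v1 j - (dot I u1 v1 * u1 j + dot I u2 v1 * u2 j))"
    define w2 where "w2 = (\<lambda>j. v2 j - (dot I u1 v2 * u1 j + dot I u2 v2 * u2 j))"
    define b1 where "b1 = (\<lambda>g. dot I u1 v1 * dot I u1 g + dot I u2 v1 * dot I u2 g)"
    define b2 where "b2 = (\<lambda>g. dot I u1 v2 * dot I u1 g + dot I u2 v2 * dot I u2 g)"
    define X where "X = (\<lambda>x. \<lambda>j\<in>I. P (fst x) j + (snd x j - P (snd x) j))"
    define H where "H = (\<lambda>g'. \<integral>g. f (b1 g' + dot I w1 g) (b2 g' + dot I w2 g) \<partial>std_gauss I)"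
    define H0 where "H0 = (\<integral>g. f (dot I w1 g) (dot I w2 g) \<partial>std_gauss I)"
    have u': "dot I u2 u1 = 0" using u by (simp add: dot_commute)
    have vu: "dot I v1 u1 = dot I u1 v1" "dot I v1 u2 = dot I u2 v1" "dot I v2 u1 = dot I u1 v2"
      "dot I v2 u2 = dot I u2 v2" "dot I v2 v1 = 0"
      using v by (simp_all add: dot_commute)
    have [measurable]: "X \<in> measurable (std_gauss I \<Otimes>\<^sub>M std_gauss I) (PiM I (\<lambda>_. borel))"
      unfolding X_def P_def by (rule measurable_restrict) simp
    have law: "distr (std_gauss I \<Otimes>\<^sub>M std_gauss I) (PiM I (\<lambda>_. borel)) X = std_gauss I"
      unfolding X_def P_def by (rule distr_std_gauss_resample[OF I u])
    have dX: "dot I u1 (X x) = dot I u1 (fst x)" "dot I u2 (X x) = dot I u2 (fst x)"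
      "dot I v1 (X x) = b1 (fst x) + dot I w1 (snd x)" "dot I v2 (X x) = b2 (fst x) + dot I w2 (snd x)" for x
      by (simp_all add: X_def P_def dot_restrict_right dot_right dot_left u u' vu w1_def w2_def b1_def b2_def,
        (simp_all add: algebra_simps)?)
    have [measurable]: "b1 \<in> borel_measurable (std_gauss I)" "b2 \<in> borel_measurable (std_gauss I)"
      by (simp_all add: b1_def b2_def)
    have [measurable]: "H \<in> borel_measurable (std_gauss I)"
      unfolding H_def by measurable
    have H01: "0 \<le> H g" "H g \<le> 1" for g
      unfolding H_def using f
      by (auto intro!: integral_nonneg_AE AE_I2 G.integral_le_const G.integrable_bounded_by[where K = 1])
    have iH: "integrable (std_gauss I) (\<lambda>g. \<xi> g * H g)" if [measurable]: "\<xi> \<in> borel_measurable (std_gauss I)"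
        and "\<And>g. 0 \<le> \<xi> g" "\<And>g. \<xi> g \<le> 1" for \<xi>
      using that H01 by (intro G.integrable_bounded_by[where K = 1] bnd) auto
    \<comment> \<open>Two choices of \<open>h\<close> are needed: \<open>f\<close> for the mixed
      moment and the constant 1 for the mean of \<open>\<psi>\<close>.\<close>
    have decouple: "?E (\<lambda>g. h (dot I u1 g) (dot I u2 g) * \<psi> g) = ?E (\<lambda>g. h (dot I u1 g) (dot I u2 g) * H g)"
      if [measurable]: "case_prod h \<in> borel_measurable (borel \<Otimes>\<^sub>M borel)"
        and h: "\<And>x y. 0 \<le> h x y" "\<And>x y. h x y \<le> 1" for h
    proof -
      have "?E (\<lambda>g. h (dot I u1 g) (dot I u2 g) * \<psi> g)
          = (\<integral>g. h (dot I u1 g) (dot I u2 g) * \<psi> g \<partial>distr (std_gauss I \<Otimes>\<^sub>M std_gauss I) (PiM I (\<lambda>_. borel)) X)"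
        unfolding law ..
      also have "\<dots> = (\<integral>x. h (dot I u1 (fst x)) (dot I u2 (fst x)) * f (b1 (fst x) + dot I w1 (snd x)) (b2 (fst x) + dot I w2 (snd x)) \<partial>(std_gauss I \<Otimes>\<^sub>M std_gauss I))"
        by (subst integral_distr) (auto simp: \<psi>_def dX)
      also have "\<dots> = ?E (\<lambda>g. h (dot I u1 g) (dot I u2 g) * H g)"
        using h f by (subst GG.integral_fst'[symmetric]) (auto simp: H_def intro!: GG.integrable_bounded_by[where K = 1] bnd)
      finally show ?thesis .
    qed
    define R where "R = (\<lambda>g. 4 * m * ((dot I u1 g)\<^sup>2 + (dot I u2 g)\<^sup>2))"
    have HR: "\<bar>H g' - H0\<bar> \<le> R g'" for g'
    proof -
      from True have "(dot I u1 v1)\<^sup>2 + (dot I u1 v2)\<^sup>2 + (dot I u2 v1)\<^sup>2 + (dot I u2 v2)\<^sup>2 \<le> 1/2" by (simp add: m_def)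
      from small_perturbation_solvable[OF this, of "dot I u1 g'" "dot I u2 g'"]
      obtain \<beta>1 \<beta>2 where \<beta>:
        "\<beta>1 - (dot I u1 v1 * (dot I u1 v1 * \<beta>1 + dot I u1 v2 * \<beta>2) + dot I u2 v1 * (dot I u2 v1 * \<beta>1 + dot I u2 v2 * \<beta>2)) = b1 g'"
        "\<beta>2 - (dot I u1 v2 * (dot I u1 v1 * \<beta>1 + dot I u1 v2 * \<beta>2) + dot I u2 v2 * (dot I u2 v1 * \<beta>1 + dot I u2 v2 * \<beta>2)) = b2 g'"
        "\<beta>1\<^sup>2 + \<beta>2\<^sup>2 \<le> R g'"
        unfolding b1_def b2_def R_def m_def by metis
      \<comment> \<open>Seeking \<open>c\<close> in the span of the orthonormal \<open>v1\<close>,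
        \<open>v2\<close> makes its squared length
        \<open>\<beta>1\<^sup>2 + \<beta>2\<^sup>2\<close>; the inner products with
        \<open>w1\<close> and \<open>w2\<close> are then exactly the left-hand sides of the solved
        system.\<close>
      define c where "c = (\<lambda>j. \<beta>1 * v1 j + \<beta>2 * v2 j)"
      have "dot I w1 c = b1 g'" "dot I w2 c = b2 g'"
        unfolding \<beta>(1,2)[symmetric] by (simp_all add: w1_def w2_def c_def dot_left dot_right v vu,
          (simp_all add: algebra_simps)?)
      from even_linear_shift_bound[where f = f, OF I _ f even this]
      have "\<bar>H g' - H0\<bar> \<le> dot I c c" by (simp add: H_def H0_def)
      also have "dot I c c = \<beta>1\<^sup>2 + \<beta>2\<^sup>2"
        by (simp add: c_def dot_left dot_right v vu power2_eq_square)
      finally show ?thesis using \<beta>(3) by simp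
    qed
    have iR: "integrable (std_gauss I) R" "?E R = 8 * m"
      unfolding R_def using second_moment_dot_unit[OF I u(1)] second_moment_dot_unit[OF I u(2)] by auto
    have approx: "\<bar>?E (\<lambda>g. \<xi> g * H g) - H0 * ?E \<xi>\<bar> \<le> 8 * m"
      if [measurable]: "\<xi> \<in> borel_measurable (std_gauss I)" and \<xi>: "\<And>g. 0 \<le> \<xi> g" "\<And>g. \<xi> g \<le> 1" for \<xi>
    proof -
      have i\<xi>: "integrable (std_gauss I) \<xi>"
        using \<xi> by (intro G.integrable_bounded_by[where K = 1]) (auto simp: abs_le_iff intro: order_trans[of _ 0])
      have "?E (\<lambda>g. \<xi> g * H g) - H0 * ?E \<xi> = ?E (\<lambda>g. \<xi> g * H g - H0 * \<xi> g)"
        using i\<xi> iH[of \<xi>] \<xi> by simp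
      also have "\<bar>\<dots>\<bar> \<le> ?E R"
      proof (rule integral_abs_bound[THEN order_trans], rule integral_mono)
        show "integrable (std_gauss I) (\<lambda>g. \<bar>\<xi> g * H g - H0 * \<xi> g\<bar>)"
          using i\<xi> iH[of \<xi>] \<xi> by auto
        fix g
        have "\<bar>\<xi> g * H g - H0 * \<xi> g\<bar> = \<xi> g * \<bar>H g - H0\<bar>"
          using \<xi>(1)[of g] abs_mult[of "\<xi> g" "H g - H0"] by (simp add: algebra_simps)
        also have "\<dots> \<le> 1 * \<bar>H g - H0\<bar>" using \<xi> by (intro mult_right_mono) auto
        finally show "\<bar>\<xi> g * H g - H0 * \<xi> g\<bar> \<le> R g" using HR[of g] by simp
      qed (rule iR)
      finally show ?thesis using iR by simp
    qed
    have 1: "\<bar>?E (\<lambda>g. \<phi> g * \<psi> g) - H0 * ?E \<phi>\<bar> \<le> 8 * m"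
      using approx[of \<phi>] \<phi> decouple[of f] f by (simp add: \<phi>_def)
    have 2: "\<bar>?E \<psi> - H0\<bar> \<le> 8 * m"
      using approx[of "\<lambda>_. 1"] decouple[of "\<lambda>_ _. 1"] by (simp add: G.prob_space)
    \<comment> \<open>Both the mixed moment and the mean of \<open>\<psi>\<close> are compared with
      the deterministic \<open>H0\<close>. Each comparison costs \<open>8 * m\<close>, the mean of
      \<open>R\<close>.\<close>
    have "\<bar>?E (\<lambda>g. \<phi> g * \<psi> g) - ?E \<phi> * ?E \<psi>\<bar> = \<bar>(?E (\<lambda>g. \<phi> g * \<psi> g) - H0 * ?E \<phi>) - ?E \<phi> * (?E \<psi> - H0)\<bar>"
      by (simp add: algebra_simps)
    also have "\<dots> \<le> \<bar>?E (\<lambda>g. \<phi> g * \<psi> g) - H0 * ?E \<phi>\<bar> + \<bar>?E \<phi> * (?E \<psi> - H0)\<bar>" by (rule abs_triangle_ineq4)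
    also have "\<dots> \<le> 8 * m + 1 * (8 * m)"
      unfolding abs_mult using E 1 2 by (intro add_mono mult_mono) auto
    finally show ?thesis by (simp add: \<phi>_def \<psi>_def)
  qed
qed

subsection \<open>The probability of opposite signs\<close>

text \<open>Comparing \<open>sgn1\<close> values would not be an even function, because
  \<open>sgn1\<close> treats 0 as positive. Strict opposition is even everywhere and differs from
  that comparison only at ties.\<close>

definition opp :: "real \<Rightarrow> real \<Rightarrow> real" where
  "opp x y = (if x * y < 0 then 1 else 0)"

lemma opp_bounds: "0 \<le> opp x y" "opp x y \<le> 1"
  by (simp_all add: opp_def)

lemma opp_minus: "opp (- x) (- y) = opp x y"
  by (simp add: opp_def)

lemma borel_measurable_opp: "case_prod opp \<in> borel_measurable (borel \<Otimes>\<^sub>M borel)"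
  unfolding opp_def[abs_def] by measurable

lemma borel_measurable_opp'[measurable (raw)]:
  "f \<in> borel_measurable M \<Longrightarrow> h \<in> borel_measurable M \<Longrightarrow> (\<lambda>x. opp (f x) (h x)) \<in> borel_measurable M"
  unfolding opp_def by measurable

definition unit_vec :: "real \<Rightarrow> bool \<Rightarrow> real" where
  "unit_vec \<alpha> b = (if b then cos \<alpha> else sin \<alpha>)"

lemma dot_unit_vec: "dot UNIV (unit_vec \<alpha>) (unit_vec \<beta>) = cos (\<alpha> - \<beta>)"
  by (simp add: dot_def unit_vec_def UNIV_bool cos_diff)

definition sep_prob :: "real \<Rightarrow> real" where
  "sep_prob \<alpha> = (\<integral>g. opp (dot UNIV (unit_vec 0) g) (dot UNIV (unit_vec \<alpha>) g) \<partial>std_gauss UNIV)"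

text \<open>Only the Gram matrix matters, so every pair of unit vectors reduces to the plane. No
  range is imposed on \<open>\<alpha>\<close>, which permits replacing it by
  \<open>- \<alpha>\<close>.\<close>

lemma integral_opp_eq_sep_prob:
  assumes "finite I" "dot I a a = 1" "dot I b b = 1" "dot I a b = cos \<alpha>"
  shows "(\<integral>g. opp (dot I a g) (dot I b g) \<partial>std_gauss I) = sep_prob \<alpha>"
  unfolding sep_prob_def using assms
  by (intro integral_dot_pair_cong borel_measurable_opp) (auto simp: dot_unit_vec)

lemma integrable_opp:
  "integrable (std_gauss I) (\<lambda>g. opp (dot I a g) (dot I b g))"
proof -
  interpret prob_space "std_gauss I" by (rule prob_space_std_gauss)
  show ?thesis by (rule integrable_bounded_by[where K = 1]) (simp_all add: opp_def)
qed

lemma AE_dot_unit_vec: "AE g in std_gauss UNIV. dot UNIV (unit_vec \<alpha>) g \<noteq> 0"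
  by (rule AE_dot_neq_0) (simp_all add: dot_unit_vec)

lemma sep_prob_bounds: "0 \<le> sep_prob \<alpha>" "sep_prob \<alpha> \<le> 1"
proof -
  interpret prob_space "std_gauss (UNIV :: bool set)" by (rule prob_space_std_gauss)
  show "0 \<le> sep_prob \<alpha>" unfolding sep_prob_def by (simp add: opp_def)
  show "sep_prob \<alpha> \<le> 1" unfolding sep_prob_def
    by (intro integral_le_const integrable_opp) (simp add: opp_def)
qed

lemma sep_prob_0: "sep_prob 0 = 0"
proof -
  have "opp x x = 0" for x by (simp add: opp_def not_less)
  then show ?thesis by (simp add: sep_prob_def)
qed

text \<open>Up to ties, negating one of two vectors exchanges equal and opposite signs, and
  \<open>unit_vec (pi - \<alpha>)\<close> is the negative of
  \<open>unit_vec (- \<alpha>)\<close>.\<close>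

lemma sep_prob_reflect: "sep_prob (pi - \<alpha>) = 1 - sep_prob \<alpha>"
proof -
  interpret prob_space "std_gauss (UNIV :: bool set)" by (rule prob_space_std_gauss)
  have "sep_prob \<alpha> = (\<integral>g. opp (dot UNIV (unit_vec 0) g) (dot UNIV (unit_vec (- \<alpha>)) g) \<partial>std_gauss UNIV)"
    by (rule integral_opp_eq_sep_prob[symmetric]) (auto simp: dot_unit_vec)
  also have "\<dots> = (\<integral>g. 1 - opp (dot UNIV (unit_vec 0) g) (dot UNIV (unit_vec (pi - \<alpha>)) g) \<partial>std_gauss UNIV)"
  proof (rule integral_cong_AE)
    have neg: "dot UNIV (unit_vec (pi - \<alpha>)) g = - dot UNIV (unit_vec (- \<alpha>)) g" for g
      by (simp add: dot_def unit_vec_def UNIV_bool)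
    show "AE g in std_gauss UNIV. opp (dot UNIV (unit_vec 0) g) (dot UNIV (unit_vec (- \<alpha>)) g)
        = 1 - opp (dot UNIV (unit_vec 0) g) (dot UNIV (unit_vec (pi - \<alpha>)) g)"
      using AE_dot_unit_vec[of 0] AE_dot_unit_vec[of "- \<alpha>"]
    proof eventually_elim
      case (elim g)
      then have "dot UNIV (unit_vec 0) g * dot UNIV (unit_vec (- \<alpha>)) g \<noteq> 0" by simp
      then show ?case unfolding neg opp_def by auto
    qed
  qed auto
  also have "\<dots> = 1 - sep_prob (pi - \<alpha>)"
    by (simp add: sep_prob_def integrable_opp prob_space)
  finally show ?thesis by simp
qed

text \<open>For \<open>\<alpha> < pi / 2\<close> the middle one of the directions \<open>0\<close>, \<open>\<alpha>\<close>, \<open>2 * \<alpha>\<close> is a positive combination of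
  the outer ones, so the sign changes at most once along the three.\<close>

lemma sep_prob_double:
  assumes \<alpha>: "0 < \<alpha>" "\<alpha> < pi / 2"
  shows "sep_prob (2 * \<alpha>) = 2 * sep_prob \<alpha>"
proof -
  let ?Z = "\<lambda>\<alpha>. dot UNIV (unit_vec \<alpha>)"
  have comb: "?Z 0 g + ?Z (2 * \<alpha>) g = 2 * cos \<alpha> * ?Z \<alpha> g" for g
    by (simp add: dot_def unit_vec_def UNIV_bool cos_double_cos sin_double,
        simp add: algebra_simps power2_eq_square)
  have pos: "cos \<alpha> > 0" using \<alpha> by (intro cos_gt_zero_pi) auto
  have "sep_prob (2 * \<alpha>) = (\<integral>g. opp (?Z 0 g) (?Z \<alpha> g) + opp (?Z \<alpha> g) (?Z (2 * \<alpha>) g) \<partial>std_gauss UNIV)"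
    unfolding sep_prob_def
  proof (rule integral_cong_AE)
    show "AE g in std_gauss UNIV. opp (?Z 0 g) (?Z (2 * \<alpha>) g) = opp (?Z 0 g) (?Z \<alpha> g) + opp (?Z \<alpha> g) (?Z (2 * \<alpha>) g)"
      using AE_dot_unit_vec[of 0] AE_dot_unit_vec[of \<alpha>] AE_dot_unit_vec[of "2 * \<alpha>"]
    proof eventually_elim
      case (elim g)
      have "?Z \<alpha> g > 0" if "?Z 0 g > 0" "?Z (2 * \<alpha>) g > 0"
        using that comb[of g] pos by (smt (verit) zero_less_mult_pos)
      moreover have "?Z \<alpha> g < 0" if "?Z 0 g < 0" "?Z (2 * \<alpha>) g < 0"
        using that comb[of g] pos by (smt (verit) mult_nonneg_nonneg)
      ultimately show ?case
        using elim by (auto simp: opp_def mult_less_0_iff not_less)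
    qed
  qed auto
  also have "\<dots> = sep_prob \<alpha> + (\<integral>g. opp (?Z \<alpha> g) (?Z (2 * \<alpha>) g) \<partial>std_gauss UNIV)"
    by (simp add: sep_prob_def integrable_opp)
  also have "(\<integral>g. opp (?Z \<alpha> g) (?Z (2 * \<alpha>) g) \<partial>std_gauss UNIV) = sep_prob \<alpha>"
    by (rule integral_opp_eq_sep_prob) (auto simp: dot_unit_vec)
  finally show ?thesis by simp
qed

text \<open>The error \<open>sep_prob \<alpha> - \<alpha> / pi\<close> is odd under \<open>\<alpha> \<mapsto> pi - \<alpha>\<close> and doubles with \<open>\<alpha>\<close>, so any bound
  on it can be halved.\<close>

lemma sep_prob_approx:
  "0 < \<alpha> \<Longrightarrow> \<alpha> < pi \<Longrightarrow> \<bar>sep_prob \<alpha> - \<alpha> / pi\<bar> \<le> 1 / 2 ^ n"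
proof (induction n arbitrary: \<alpha>)
  case 0
  then have "0 \<le> \<alpha> / pi" "\<alpha> / pi \<le> 1" by simp_all
  then show ?case using sep_prob_bounds[of \<alpha>] by (simp add: abs_le_iff del: divide_le_eq_1_pos)
next
  case (Suc n)
  have low: "\<bar>sep_prob \<alpha> - \<alpha> / pi\<bar> \<le> 1 / 2 ^ Suc n" if "0 < \<alpha>" "\<alpha> < pi / 2" for \<alpha>
  proof -
    have "sep_prob (2 * \<alpha>) - 2 * \<alpha> / pi = 2 * (sep_prob \<alpha> - \<alpha> / pi)"
      by (simp add: sep_prob_double[OF that])
    then have "\<bar>2 * (sep_prob \<alpha> - \<alpha> / pi)\<bar> \<le> 1 / 2 ^ n"
      using Suc.IH[of "2 * \<alpha>"] that by simp
    then show ?thesis by (simp add: abs_mult)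
  qed
  have refl: "sep_prob \<alpha> - \<alpha> / pi = - (sep_prob (pi - \<alpha>) - (pi - \<alpha>) / pi)"
    by (simp add: sep_prob_reflect diff_divide_distrib)
  consider "\<alpha> < pi / 2" | "\<alpha> = pi / 2" | "\<alpha> > pi / 2" by linarith
  then show ?case
  proof cases
    case 1
    with low Suc.prems show ?thesis by simp
  next
    case 2
    \<comment> \<open>Doubling would leave the open interval here, but \<open>pi / 2\<close> is the
      fixed point of the reflection, so the error equals its own negative.\<close>
    then have "pi - \<alpha> = \<alpha>" by simp
    then have "sep_prob \<alpha> - \<alpha> / pi = 0" using refl unfolding \<open>pi - \<alpha> = \<alpha>\<close> by linarith
    then show ?thesis by (simp only:) simp
  next
    case 3
    with low[of "pi - \<alpha>"] Suc.prems show ?thesis unfolding refl by simp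
  qed
qed

lemma sep_prob_eq:
  assumes "0 \<le> \<alpha>" "\<alpha> \<le> pi"
  shows "sep_prob \<alpha> = \<alpha> / pi"
proof -
  consider "\<alpha> = 0" | "\<alpha> = pi" | "0 < \<alpha>" "\<alpha> < pi" using assms by linarith
  then show ?thesis
  proof cases
    case 3
    have "(\<lambda>n. 1 / 2 ^ n :: real) \<longlonglongrightarrow> 0"
      using LIMSEQ_realpow_zero[of "1/2"] by (simp add: power_divide)
    then have "\<bar>sep_prob \<alpha> - \<alpha> / pi\<bar> \<le> 0"
      using sep_prob_approx[OF 3] by (intro LIMSEQ_le_const) auto
    then show ?thesis by simp
  qed (use sep_prob_0 sep_prob_reflect[of 0] in auto)
qed

lemma integral_opp:
  assumes "finite I" "dot I a a = 1" "dot I b b = 1"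
  shows "(\<integral>g. opp (dot I a g) (dot I b g) \<partial>std_gauss I) = arccos (dot I a b) / pi"
proof -
  have "(dot I a b)\<^sup>2 \<le> 1" using dot_square_le[of I a b] assms by simp
  then have "-1 \<le> dot I a b" "dot I a b \<le> 1" by (auto simp: abs_square_le_1 abs_le_iff)
  then show ?thesis
    using assms by (subst integral_opp_eq_sep_prob[where \<alpha> = "arccos (dot I a b)"])
      (auto simp: arccos_lbound arccos_ubound sep_prob_eq)
qed

subsection \<open>Orthonormal pairs and random signs\<close>

text \<open>One Gram-Schmidt step; the hypothesis excludes \<open>r\<close> being plus or minus
  \<open>p\<close>, where the normalising factor would vanish.\<close>

lemma orthonormalize:
  assumes "dot I p p = 1" "dot I r r = 1" "(dot I p r)\<^sup>2 \<noteq> 1"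
  obtains q where "dot I q q = 1" "dot I p q = 0"
    "\<And>j. r j = dot I p r * p j + sqrt (1 - (dot I p r)\<^sup>2) * q j"
proof -
  define \<rho> where "\<rho> = dot I p r"
  have "\<rho>\<^sup>2 < 1" using dot_square_le[of I p r] assms by (simp add: \<rho>_def)
  then have s: "sqrt (1 - \<rho>\<^sup>2) > 0" "(sqrt (1 - \<rho>\<^sup>2))\<^sup>2 = 1 - \<rho>\<^sup>2" by auto
  define q where "q = (\<lambda>j. (1 / sqrt (1 - \<rho>\<^sup>2)) * (r j - \<rho> * p j))"
  have \<rho>': "dot I r p = \<rho>" "dot I p r = \<rho>" by (simp_all add: \<rho>_def dot_commute)
  show thesis
  proof
    have "dot I q q = (1 - \<rho>\<^sup>2) / (sqrt (1 - \<rho>\<^sup>2))\<^sup>2"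
      unfolding q_def dot_left dot_right \<rho>' assms by (simp add: power2_eq_square)
    also have "\<dots> = 1" using s by simp
    finally show "dot I q q = 1" .
    show "dot I p q = 0"
      unfolding q_def dot_left dot_right \<rho>' assms by simp
    show "r j = dot I p r * p j + sqrt (1 - (dot I p r)\<^sup>2) * q j" for j
      unfolding \<rho>_def[symmetric] using s by (simp add: q_def)
  qed
qed

text \<open>If \<open>r\<close> is plus or minus \<open>p\<close> on \<open>I\<close>, the
  coefficient of \<open>q\<close> is 0 and any unit vector orthogonal to \<open>p\<close> will do.
  Such a vector exists because \<open>I\<close> has two distinct elements.\<close>

lemma orthonormal_decomposition:
  fixes I :: "'i set"
  assumes I: "finite I" "i \<in> I" "j \<in> I" "i \<noteq> j" and p: "dot I p p = 1" and r: "dot I r r = 1"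
  obtains q where "dot I q q = 1" "dot I p q = 0"
    "\<And>j. j \<in> I \<Longrightarrow> r j = dot I p r * p j + sqrt (1 - (dot I p r)\<^sup>2) * q j"
proof (cases "(dot I p r)\<^sup>2 = 1")
  case False
  with orthonormalize[OF p r] that show thesis by metis
next
  case True
  let ?\<rho> = "dot I p r"
  have "dot I (\<lambda>j. r j - ?\<rho> * p j) (\<lambda>j. r j - ?\<rho> * p j) = 0"
    unfolding dot_left dot_right p r dot_commute[of I r p] using True by (simp add: power2_eq_square)
  then have eq: "r j = ?\<rho> * p j" if "j \<in> I" for j
    using that I by (auto simp: dot_def sum_nonneg_eq_0_iff)
  define e where "e = (\<lambda>(k::'i) l. if l = k then 1 else 0 :: real)"
  have e: "dot I (e k) (e k) = 1" "dot I p (e k) = p k" if "k \<in> I" for k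
    using that I by (simp_all add: dot_def e_def if_distrib[of "\<lambda>x. _ * x"] cong: if_cong)
  have "(p i)\<^sup>2 + (p j)\<^sup>2 = (\<Sum>k\<in>{i, j}. p k * p k)" using I by (simp add: power2_eq_square)
  also have "\<dots> \<le> dot I p p" unfolding dot_def using I by (intro sum_mono2) auto
  \<comment> \<open>Two entries of a unit vector cannot both have square 1, so one of the two basis
    vectors is not parallel to \<open>p\<close> and can be orthonormalised against it.\<close>
  finally have "(p i)\<^sup>2 \<noteq> 1 \<or> (p j)\<^sup>2 \<noteq> 1" using p by auto
  then obtain k where k: "k \<in> I" "(p k)\<^sup>2 \<noteq> 1" using I by blast
  obtain q where "dot I q q = 1" "dot I p q = 0"
    using orthonormalize[OF p e(1)[OF k(1)]] e(2)[OF k(1)] k(2) by metis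
  with that eq True show thesis by simp
qed

section \<open>Moments of random signs\<close>

abbreviation rademacher :: "'i set \<Rightarrow> ('i \<Rightarrow> real) measure" where
  "rademacher I \<equiv> PiM I (\<lambda>_. measure_pmf (pmf_of_set {-1::real, 1}))"

lemma prob_space_rademacher: "prob_space (rademacher I)"
  by (intro prob_space_PiM prob_space_measure_pmf)

lemma borel_measurable_rademacher[measurable]:
  assumes "j \<in> I"
  shows "(\<lambda>d. d j) \<in> borel_measurable (rademacher I)"
  using measurable_compose[OF measurable_component_singleton[OF assms, of "\<lambda>_. measure_pmf (pmf_of_set {-1::real, 1})"], of "\<lambda>x. x" borel]
  by simp

text \<open>The underlying space of the pmf is the whole real line, so the entries are signs only
  almost everywhere.\<close>

lemma AE_rademacher:
  assumes "finite I"
  shows "AE d in rademacher I. \<forall>j\<in>I. (d j)\<^sup>2 = 1"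
proof -
  have "AE d in rademacher I. (d j)\<^sup>2 = 1" if "j \<in> I" for j
    using that by (intro AE_PiM_component prob_space_measure_pmf) (auto simp: AE_measure_pmf_iff)
  then show ?thesis using assms by (intro AE_finite_allI) auto
qed

lemma rademacher_odd_moment:
  assumes I: "finite I" and abce: "a \<in> I" "b \<in> I" "c \<in> I" "e \<in> I" and a: "a \<noteq> b" "a \<noteq> c" "a \<noteq> e"
  shows "(\<integral>d. d a * d b * d c * d e \<partial>rademacher I) = 0"
proof -
  interpret product_sigma_finite "\<lambda>_::'a. measure_pmf (pmf_of_set {-1::real, 1})"
    by (simp add: product_sigma_finite_def measure_pmf.sigma_finite_measure_axioms)
  \<comment> \<open>Writes the monomial as a product over all of \<open>I\<close>, repeated indices
    becoming powers. The index \<open>a\<close> occurs once, so its factor is a single sign of mean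
    0.\<close>
  define h where "h = (\<lambda>i x. (if i = a then x else 1) * (if i = b then x else 1) * (if i = c then x else 1) * (if i = e then x else 1 :: real))"
  have "(\<integral>d. d a * d b * d c * d e \<partial>rademacher I) = (\<integral>d. (\<Prod>i\<in>I. h i (d i)) \<partial>rademacher I)"
    using I abce by (simp add: h_def prod.distrib prod.delta)
  also have "\<dots> = (\<Prod>i\<in>I. (\<integral>x. h i x \<partial>measure_pmf (pmf_of_set {-1, 1})))"
    using I by (intro product_integral_prod integrable_measure_pmf_finite) auto
  also have "(\<integral>x. h a x \<partial>measure_pmf (pmf_of_set {-1, 1})) = 0"
    using a by (simp add: h_def integral_pmf_of_set)
  then have "(\<Prod>i\<in>I. (\<integral>x. h i x \<partial>measure_pmf (pmf_of_set {-1, 1}))) = 0"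
    using I abce by (intro prod_zero) auto
  finally show ?thesis .
qed

text \<open>The products \<open>d j * d (\<sigma> j)\<close> are orthonormal.\<close>

lemma rademacher_chaos_second_moment:
  fixes I J :: "'i set"
  assumes I: "finite I" and J: "J \<subseteq> I" "\<sigma> ` J \<subseteq> I"
    and \<sigma>: "\<And>j. j \<in> J \<Longrightarrow> \<sigma> j \<noteq> j" "\<And>j l. j \<in> J \<Longrightarrow> l \<in> J \<Longrightarrow> j \<noteq> l \<Longrightarrow> {j, \<sigma> j} \<noteq> {l, \<sigma> l}"
  shows "integrable (rademacher I) (\<lambda>d. (\<Sum>j\<in>J. c j * d j * d (\<sigma> j))\<^sup>2)" (is "integrable _ ?S")
    and "(\<integral>d. (\<Sum>j\<in>J. c j * d j * d (\<sigma> j))\<^sup>2 \<partial>rademacher I) = (\<Sum>j\<in>J. (c j)\<^sup>2)"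
proof -
  interpret prob_space "rademacher I" by (rule prob_space_rademacher)
  have fJ: "finite J" using J(1) I by (rule finite_subset)
  define T where "T = (\<lambda>j l d. (c j * c l) * (d j * d (\<sigma> j) * d l * d (\<sigma> l) :: real))"
  have mem: "j \<in> I" "\<sigma> j \<in> I" if "j \<in> J" for j using that J by auto
  have S: "?S d = (\<Sum>j\<in>J. \<Sum>l\<in>J. T j l d)" for d
    by (simp add: T_def power2_eq_square sum_product mult_ac)
  have iT: "integrable (rademacher I) (T j l)" if "j \<in> J" "l \<in> J" for j l
  proof (rule integrable_const_bound[where B = "\<bar>c j * c l\<bar>"])
    show "AE d in rademacher I. norm (T j l d) \<le> \<bar>c j * c l\<bar>"
      using AE_rademacher[OF I]
    proof eventually_elim
      case (elim d)
      have "\<bar>d i\<bar> = 1" if "i \<in> I" for i using elim that by (simp add: abs_square_eq_1)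
      then show ?case using mem that by (simp add: T_def abs_mult)
    qed
    show "T j l \<in> borel_measurable (rademacher I)"
      unfolding T_def using mem that by measurable
  qed
  show "integrable (rademacher I) ?S"
    unfolding S using iT by (intro Bochner_Integration.integrable_sum) auto
  have ET: "(\<integral>d. T j l d \<partial>rademacher I) = (if j = l then (c j)\<^sup>2 else 0)" if jl: "j \<in> J" "l \<in> J" for j l
  proof (cases "j = l")
    case True
    have "(\<integral>d. T j l d \<partial>rademacher I) = (\<integral>d. (c j)\<^sup>2 \<partial>rademacher I)"
    proof (rule integral_cong_AE)
      show "AE d in rademacher I. T j l d = (c j)\<^sup>2"
        using AE_rademacher[OF I]
      proof eventually_elim
        case (elim d)
        have "T j l d = (c j)\<^sup>2 * ((d j)\<^sup>2 * (d (\<sigma> j))\<^sup>2)" using True by (simp add: T_def power2_eq_square)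
        then show ?case using elim mem jl by simp
      qed
    qed (use iT jl in auto)
    then show ?thesis using True by (simp add: prob_space)
  next
    case False
    have ne: "\<sigma> j \<noteq> j" "\<sigma> l \<noteq> l" "{j, \<sigma> j} \<noteq> {l, \<sigma> l}" using \<sigma> jl False by auto
    \<comment> \<open>Two distinct pairs leave an index that occurs exactly once: \<open>j\<close>
      itself, or \<open>\<sigma> j\<close> in case \<open>j = \<sigma> l\<close>.\<close>
    have "(\<integral>d. d j * d (\<sigma> j) * d l * d (\<sigma> l) \<partial>rademacher I) = 0"
    proof (cases "j = \<sigma> l")
      case True
      then have "\<sigma> j \<noteq> l" "\<sigma> j \<noteq> \<sigma> l" using ne by auto
      then have "(\<integral>d. d (\<sigma> j) * d j * d l * d (\<sigma> l) \<partial>rademacher I) = 0"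
        using ne mem jl by (intro rademacher_odd_moment I) auto
      then show ?thesis by (simp add: mult_ac)
    next
      case nt: False
      then show ?thesis
        using ne mem jl False by (intro rademacher_odd_moment I) auto
    qed
    then show ?thesis using False by (simp add: T_def)
  qed
  have "(\<integral>d. ?S d \<partial>rademacher I) = (\<Sum>j\<in>J. \<Sum>l\<in>J. (\<integral>d. T j l d \<partial>rademacher I))"
    unfolding S using iT by (simp add: Bochner_Integration.integral_sum Bochner_Integration.integrable_sum)
  also have "\<dots> = (\<Sum>j\<in>J. (c j)\<^sup>2)"
    using fJ by (simp add: ET cong: sum.cong)
  finally show "(\<integral>d. ?S d \<partial>rademacher I) = (\<Sum>j\<in>J. (c j)\<^sup>2)" .
qed

subsection \<open>Second moment of the approximate angle\<close>

text \<open>Row \<open>i\<close> of the projection matrix composed with the sign flips \<open>d\<close>, as a linear functional of the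
  Gaussians \<open>g\<^sub>1, \<dots>, g\<^bsub>n+k-1\<^esub>\<close>: the entry \<open>d j * x j\<close> sits at position \<open>l = j + k - i\<close>.\<close>

definition hash_row :: "nat \<Rightarrow> nat \<Rightarrow> (nat \<Rightarrow> real) \<Rightarrow> (nat \<Rightarrow> real) \<Rightarrow> nat \<Rightarrow> nat \<Rightarrow> real" where
  "hash_row n k d x i l = (if k < l + i \<and> l + i \<le> n + k then d (l + i - k) * x (l + i - k) else 0)"

lemma dot_hash_row:
  assumes i: "i \<in> {1..k}"
  shows "dot {1..n + k - 1} (hash_row n k d x i) h = (\<Sum>j=1..n. d j * x j * h (j + k - i))"
proof -
  have "dot {1..n + k - 1} (hash_row n k d x i) h
      = (\<Sum>l\<in>(\<lambda>j. j + k - i) ` {1..n}. hash_row n k d x i l * h l)"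
    unfolding dot_def
  proof (rule sum.mono_neutral_right)
    show "(\<lambda>j. j + k - i) ` {1..n} \<subseteq> {1..n + k - 1}" using i by auto
    show "\<forall>l\<in>{1..n + k - 1} - (\<lambda>j. j + k - i) ` {1..n}. hash_row n k d x i l * h l = 0"
    proof
      fix l assume l: "l \<in> {1..n + k - 1} - (\<lambda>j. j + k - i) ` {1..n}"
      have "\<not> (k < l + i \<and> l + i \<le> n + k)"
      proof
        assume a: "k < l + i \<and> l + i \<le> n + k"
        then have "l = (l + i - k) + k - i" "l + i - k \<in> {1..n}" by auto
        with l show False by blast
      qed
      then show "hash_row n k d x i l * h l = 0" by (auto simp: hash_row_def)
    qed
  qed simp
  also have "\<dots> = (\<Sum>j=1..n. hash_row n k d x i (j + k - i) * h (j + k - i))"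
    using i by (subst sum.reindex) (auto simp: inj_on_def)
  also have "\<dots> = (\<Sum>j=1..n. d j * x j * h (j + k - i))"
    using i by (intro sum.cong) (auto simp: hash_row_def)
  finally show ?thesis .
qed

lemma dot_hash_row_same:
  assumes "i \<in> {1..k}" "\<forall>j\<in>{1..n}. (d j)\<^sup>2 = 1"
  shows "dot {1..n + k - 1} (hash_row n k d x i) (hash_row n k d y i) = dot {1..n} x y"
  unfolding dot_hash_row[OF assms(1)] unfolding dot_def
proof (rule sum.cong)
  fix j assume j: "j \<in> {1..n}"
  have "hash_row n k d y i (j + k - i) = d j * y j" using assms j by (auto simp: hash_row_def)
  then have "d j * x j * hash_row n k d y i (j + k - i) = (d j)\<^sup>2 * (x j * y j)"
    by (simp add: power2_eq_square)
  then show "d j * x j * hash_row n k d y i (j + k - i) = x j * y j" using assms j by simp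
qed simp

text \<open>Both rows sit at shifted positions and meet where \<open>j + i' - i\<close> lies in
  \<open>{1..n}\<close>. The two inequalities express this without truncated subtraction.\<close>

lemma dot_hash_row_other:
  assumes i: "i \<in> {1..k}"
  shows "dot {1..n + k - 1} (hash_row n k d x i) (hash_row n k d y i')
    = (\<Sum>j | j \<in> {1..n} \<and> i < j + i' \<and> j + i' \<le> n + i. x j * y (j + i' - i) * d j * d (j + i' - i))"
proof -
  have "dot {1..n + k - 1} (hash_row n k d x i) (hash_row n k d y i')
      = (\<Sum>j=1..n. if i < j + i' \<and> j + i' \<le> n + i then x j * y (j + i' - i) * d j * d (j + i' - i) else 0)"
    unfolding dot_hash_row[OF i]
  proof (rule sum.cong)
    fix j assume j: "j \<in> {1..n}"
    then have "k < j + k - i + i' \<longleftrightarrow> i < j + i'" "j + k - i + i' \<le> n + k \<longleftrightarrow> j + i' \<le> n + i"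
      "j + k - i + i' - k = j + i' - i" using i by auto
    then show "d j * x j * hash_row n k d y i' (j + k - i)
        = (if i < j + i' \<and> j + i' \<le> n + i then x j * y (j + i' - i) * d j * d (j + i' - i) else 0)"
      by (simp add: hash_row_def mult_ac)
  qed simp
  also have "\<dots> = (\<Sum>j | j \<in> {1..n} \<and> i < j + i' \<and> j + i' \<le> n + i. x j * y (j + i' - i) * d j * d (j + i' - i))"
    by (rule sum.inter_filter[symmetric]) simp
  finally show ?thesis .
qed

text \<open>A nonzero shift \<open>i' - i\<close> has no fixed point, and a pair at a given distance
  is determined by its smaller element. The sign products in the correlation are therefore
  orthonormal.\<close>

lemma row_correlation_second_moment:
  assumes i: "i \<in> {1..k}" and ne: "i \<noteq> i'"
  shows "integrable (rademacher {1..n}) (\<lambda>d. (dot {1..n + k - 1} (hash_row n k d x i) (hash_row n k d y i'))\<^sup>2)"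
    and "(\<integral>d. (dot {1..n + k - 1} (hash_row n k d x i) (hash_row n k d y i'))\<^sup>2 \<partial>rademacher {1..n})
      = (\<Sum>j | j \<in> {1..n} \<and> i < j + i' \<and> j + i' \<le> n + i. (x j * y (j + i' - i))\<^sup>2)"
proof -
  let ?J = "{j \<in> {1..n}. i < j + i' \<and> j + i' \<le> n + i}"
  have J: "?J \<subseteq> {1..n}" "(\<lambda>j. j + i' - i) ` ?J \<subseteq> {1..n}" by auto
  have 1: "j + i' - i \<noteq> j" if "j \<in> ?J" for j using that ne by auto
  have 2: "{j, j + i' - i} \<noteq> {l, l + i' - i}" if "j \<in> ?J" "l \<in> ?J" "j \<noteq> l" for j l
    using that ne by (auto simp: doubleton_eq_iff)
  note * = rademacher_chaos_second_moment[OF finite_atLeastAtMost J 1 2, of "\<lambda>j. x j * y (j + i' - i)"]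
  show "integrable (rademacher {1..n}) (\<lambda>d. (dot {1..n + k - 1} (hash_row n k d x i) (hash_row n k d y i'))\<^sup>2)"
    unfolding dot_hash_row_other[OF i] by (rule *(1))
  show "(\<integral>d. (dot {1..n + k - 1} (hash_row n k d x i) (hash_row n k d y i'))\<^sup>2 \<partial>rademacher {1..n})
      = (\<Sum>j\<in>?J. (x j * y (j + i' - i))\<^sup>2)"
    unfolding dot_hash_row_other[OF i] by (rule *(2))
qed

text \<open>For fixed \<open>j\<close> the map from \<open>i'\<close> to \<open>j + i' - i\<close>
  is injective, so each entry of \<open>y\<close> meets \<open>x j\<close> at most once; the bound
  does not grow with \<open>k\<close>.\<close>

lemma sum_row_correlations_le:
  assumes i: "i \<in> {1..k}"
  shows "(\<Sum>i'\<in>{1..k} - {i}. \<integral>d. (dot {1..n + k - 1} (hash_row n k d x i) (hash_row n k d y i'))\<^sup>2 \<partial>rademacher {1..n})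
    \<le> dot {1..n} x x * dot {1..n} y y"
proof -
  have "(\<Sum>i'\<in>{1..k} - {i}. \<integral>d. (dot {1..n + k - 1} (hash_row n k d x i) (hash_row n k d y i'))\<^sup>2 \<partial>rademacher {1..n})
      = (\<Sum>i'\<in>{1..k} - {i}. \<Sum>j | j \<in> {1..n} \<and> i < j + i' \<and> j + i' \<le> n + i. (x j * y (j + i' - i))\<^sup>2)"
    using row_correlation_second_moment(2)[OF i] by (intro sum.cong) auto
  also have "\<dots> = (\<Sum>i'\<in>{1..k} - {i}. \<Sum>j=1..n. if i < j + i' \<and> j + i' \<le> n + i then (x j * y (j + i' - i))\<^sup>2 else 0)"
    by (intro sum.cong sum.inter_filter refl) simp
  also have "\<dots> = (\<Sum>j=1..n. \<Sum>i'\<in>{1..k} - {i}. if i < j + i' \<and> j + i' \<le> n + i then (x j * y (j + i' - i))\<^sup>2 else 0)"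
    by (rule sum.swap)
  also have "\<dots> \<le> (\<Sum>j=1..n. (x j)\<^sup>2 * dot {1..n} y y)"
  proof (rule sum_mono)
    fix j assume j: "j \<in> {1..n}"
    let ?K = "{i' \<in> {1..k} - {i}. i < j + i' \<and> j + i' \<le> n + i}"
    have "(\<Sum>i'\<in>{1..k} - {i}. if i < j + i' \<and> j + i' \<le> n + i then (x j * y (j + i' - i))\<^sup>2 else 0)
        = (\<Sum>i'\<in>?K. (x j * y (j + i' - i))\<^sup>2)"
      by (rule sum.inter_filter[symmetric]) simp
    also have "\<dots> = (x j)\<^sup>2 * (\<Sum>i'\<in>?K. (y (j + i' - i))\<^sup>2)"
      by (simp add: sum_distrib_left power_mult_distrib)
    also have "(\<Sum>i'\<in>?K. (y (j + i' - i))\<^sup>2) = (\<Sum>l\<in>(\<lambda>i'. j + i' - i) ` ?K. (y l)\<^sup>2)"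
      by (subst sum.reindex) (auto simp: inj_on_def)
    also have "\<dots> \<le> (\<Sum>l\<in>{1..n}. (y l)\<^sup>2)"
      by (rule sum_mono2) auto
    also have "\<dots> = dot {1..n} y y" by (simp add: dot_def power2_eq_square)
    finally show "(\<Sum>i'\<in>{1..k} - {i}. if i < j + i' \<and> j + i' \<le> n + i then (x j * y (j + i' - i))\<^sup>2 else 0)
        \<le> (x j)\<^sup>2 * dot {1..n} y y" by (simp add: mult_left_mono)
  qed
  also have "\<dots> = dot {1..n} x x * dot {1..n} y y"
    by (simp add: sum_distrib_right dot_def power2_eq_square)
  finally show ?thesis .
qed

text \<open>The quantity \<open>m\<close> of \<open>covariance_even_bound\<close> for the rows
  \<open>i\<close> and \<open>i'\<close>. Summing over the set \<open>{p, q}\<close> gives four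
  terms only when \<open>p\<close> and \<open>q\<close> differ, which orthonormality
  guarantees.\<close>

definition row_correlation :: "nat \<Rightarrow> nat \<Rightarrow> (nat \<Rightarrow> real) \<Rightarrow> (nat \<Rightarrow> real) \<Rightarrow> nat \<Rightarrow> nat \<Rightarrow> (nat \<Rightarrow> real) \<Rightarrow> real" where
  "row_correlation n k p q i i' d = (\<Sum>x\<in>{p, q}. \<Sum>y\<in>{p, q}. (dot {1..n + k - 1} (hash_row n k d x i) (hash_row n k d y i'))\<^sup>2)"

lemma abs_diff_sgn1_eq_opp:
  assumes "x \<noteq> 0" "y \<noteq> 0"
  shows "\<bar>sgn1 x - sgn1 y\<bar> = 2 * opp x y"
  using assms by (auto simp: sgn1_def opp_def mult_less_0_iff)

lemma borel_measurable_sgn1[measurable]: "sgn1 \<in> borel_measurable borel"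
  unfolding sgn1_def[abs_def] by measurable

lemma short_hash_eq:
  assumes "i \<in> {1..k}"
  shows "short_hash n k (g, d) x i = sgn1 (dot {1..n + k - 1} (hash_row n k d x i) g)"
  unfolding dot_hash_row[OF assms] by (simp add: short_hash_def toeplitz_P_def mult_ac)

text \<open>The variance of the row average at fixed signs: each of the \<open>k\<close> diagonal
  terms is at most 1, and each off-diagonal covariance is controlled by the correlation of the two
  rows.\<close>

lemma conditional_second_moment:
  assumes n: "2 \<le> k" "k \<le> n" and d: "\<forall>j\<in>{1..n}. (d j)\<^sup>2 = 1"
    and p: "dot {1..n} p p = 1" and q: "dot {1..n} q q = 1" "dot {1..n} p q = 0"
    and r: "dot {1..n} r r = 1" "\<And>j. j \<in> {1..n} \<Longrightarrow> r j = \<rho> * p j + s * q j"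
  defines "\<theta> \<equiv> arccos (dot {1..n} p r) / pi"
  shows "(\<integral>g. (approx_angle n k (g, d) p r - \<theta>)\<^sup>2 \<partial>std_gauss {1..n + k - 1})
    \<le> (real k + 16 * (\<Sum>i\<in>{1..k}. \<Sum>i'\<in>{1..k} - {i}. row_correlation n k p q i i' d)) / (real k)\<^sup>2"
proof -
  define T where "T = {1..n + k - 1}"
  have T: "finite T" by (simp add: T_def)
  let ?row = "hash_row n k d"
  interpret G: prob_space "std_gauss T" by (rule prob_space_std_gauss)
  define X where "X = (\<lambda>i g. opp (dot T (?row p i) g) (dot T (?row r i) g))"
  let ?E = "\<lambda>h. \<integral>g. h g \<partial>std_gauss T"
  note same = dot_hash_row_same[where k = k, OF _ d, folded T_def] and row = dot_hash_row[where n = n and k = k, folded T_def]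
  have X01: "0 \<le> X i g" "X i g \<le> 1" for i g by (simp_all add: X_def opp_def)
  have iX: "integrable (std_gauss T) (X i)" for i unfolding X_def by (rule integrable_opp)
  note mX[measurable] = borel_measurable_integrable[OF iX]
  have bnd: "0 \<le> a * b" "a * b \<le> 1" "\<bar>a * b\<bar> \<le> 1" if "0 \<le> a" "a \<le> 1" "0 \<le> b" "b \<le> 1" for a b :: real
    using that mult_le_one[of a b] by auto
  have iXX: "integrable (std_gauss T) (\<lambda>g. X i g * X i' g)" for i i'
    by (rule G.integrable_bounded_by[where K = 1], rule borel_measurable_times[OF mX mX], rule bnd(3)[OF X01 X01])
  have EX: "?E (X i) = \<theta>" if "i \<in> {1..k}" for i
    unfolding X_def \<theta>_def using same[OF that] p r(1) T by (simp add: integral_opp)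
  have \<theta>01: "0 \<le> \<theta>" "\<theta> \<le> 1"
  proof -
    have "0 \<le> ?E (X 1)" by (rule integral_nonneg_AE) (simp add: X01)
    moreover have "?E (X 1) \<le> 1" by (rule G.integral_le_const[OF iX]) (simp add: X01)
    ultimately show "0 \<le> \<theta>" "\<theta> \<le> 1" using EX[of 1] n by simp_all
  qed
  have AEX: "AE g in std_gauss T. approx_angle n k (g, d) p r - \<theta> = (\<Sum>i=1..k. X i g - \<theta>) / real k"
  proof -
    have ne: "AE g in std_gauss T. \<forall>i\<in>{1..k}. dot T (?row x i) g \<noteq> 0" if "dot {1..n} x x = 1" for x
      using that same T by (intro AE_finite_allI AE_dot_neq_0) auto
    from ne[OF p] ne[OF r(1)] show ?thesis
    proof eventually_elim
      case (elim g)
      have "approx_angle n k (g, d) p r = (\<Sum>i=1..k. 2 * X i g) / (2 * real k)"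
        unfolding approx_angle_def using elim
        by (intro arg_cong2[where f = "(/)"] sum.cong refl) (auto simp: short_hash_eq[where n = n and k = k, folded T_def] X_def abs_diff_sgn1_eq_opp)
      also have "\<dots> = (\<Sum>i=1..k. X i g) / real k"
        by (simp add: sum_distrib_left[symmetric])
      finally show ?case using n by (simp add: sum_subtractf field_simps)
    qed
  qed
  \<comment> \<open>Expresses the opposition of the \<open>p\<close>- and
    \<open>r\<close>-functionals through the orthonormal \<open>p\<close>- and
    \<open>q\<close>-functionals. As \<open>f\<close> composes \<open>opp\<close> with a linear map,
    it is again even.\<close>
  define f where "f = (\<lambda>x y. opp x (\<rho> * x + s * y))"
  have "\<rho> * - x + s * - y = - (\<rho> * x + s * y)" for x y by simp
  then have f: "0 \<le> f x y" "f x y \<le> 1" "f (- x) (- y) = f x y" for x y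
    by (simp_all only: f_def opp_bounds opp_minus)
  have [measurable]: "case_prod f \<in> borel_measurable (borel \<Otimes>\<^sub>M borel)"
    unfolding f_def by measurable
  have Xf: "X i g = f (dot T (?row p i) g) (dot T (?row q i) g)" if "i \<in> {1..k}" for i g
  proof -
    have "dot T (?row r i) g = \<rho> * dot T (?row p i) g + s * dot T (?row q i) g"
      unfolding row[OF that] using r(2)
      by (simp add: sum_distrib_left sum.distrib[symmetric] algebra_simps)
    then show ?thesis by (simp add: X_def f_def)
  qed
  have pq: "p \<noteq> q" using p q by auto
  have cov: "?E (\<lambda>g. X i g * X i' g) - \<theta> * \<theta> \<le> 16 * row_correlation n k p q i i' d"
    if i: "i \<in> {1..k}" "i' \<in> {1..k}" for i i'
  proof -
    have "\<bar>?E (\<lambda>g. X i g * X i' g) - ?E (X i) * ?E (X i')\<bar> \<le> 16 * row_correlation n k p q i i' d"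
      using covariance_even_bound[where f = f and I = T and ?u1.0 = "?row p i" and ?u2.0 = "?row q i"
          and ?v1.0 = "?row p i'" and ?v2.0 = "?row q i'"] f same i p q pq T
      by (simp add: Xf row_correlation_def[where n = n and k = k, folded T_def] add.assoc)
    then show ?thesis using EX i by (simp add: abs_le_iff)
  qed
  have var: "?E (\<lambda>g. (X i g - \<theta>) * (X i' g - \<theta>)) = ?E (\<lambda>g. X i g * X i' g) - \<theta> * \<theta>"
    if i: "i \<in> {1..k}" "i' \<in> {1..k}" for i i'
  proof -
    have "?E (\<lambda>g. (X i g - \<theta>) * (X i' g - \<theta>)) = ?E (\<lambda>g. X i g * X i' g - \<theta> * X i g - \<theta> * X i' g + \<theta> * \<theta>)"
      by (intro Bochner_Integration.integral_cong) (auto simp: algebra_simps)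
    also have "\<dots> = ?E (\<lambda>g. X i g * X i' g) - \<theta> * ?E (X i) - \<theta> * ?E (X i') + \<theta> * \<theta>"
      using iXX iX by (simp add: G.prob_space)
    finally show ?thesis using EX i by simp
  qed
  have iY: "integrable (std_gauss T) (\<lambda>g. (X i g - \<theta>) * (X i' g - \<theta>))" for i i'
  proof (rule G.integrable_bounded_by[where K = 1])
    have "\<bar>X i g - \<theta>\<bar> \<le> 1" for i g using X01[of i g] \<theta>01 by linarith
    then show "\<bar>(X i g - \<theta>) * (X i' g - \<theta>)\<bar> \<le> 1" for g by (simp add: abs_mult mult_le_one)
  qed (intro borel_measurable_times borel_measurable_diff mX borel_measurable_const)
  have mh: "(\<lambda>g. short_hash n k (g, d) x i) \<in> borel_measurable (std_gauss T)" if "i \<in> {1..k}" for x i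
    unfolding short_hash_eq[OF that, where n = n, folded T_def]
    by (rule measurable_compose[OF borel_measurable_dot_std_gauss borel_measurable_sgn1])
  have "(\<integral>g. (approx_angle n k (g, d) p r - \<theta>)\<^sup>2 \<partial>std_gauss T)
      = ?E (\<lambda>g. (\<Sum>i=1..k. \<Sum>i'=1..k. (X i g - \<theta>) * (X i' g - \<theta>)) / (real k)\<^sup>2)"
  proof (rule integral_cong_AE)
    show "AE g in std_gauss T. (approx_angle n k (g, d) p r - \<theta>)\<^sup>2
        = (\<Sum>i=1..k. \<Sum>i'=1..k. (X i g - \<theta>) * (X i' g - \<theta>)) / (real k)\<^sup>2"
      using AEX by eventually_elim (simp only: power_divide power2_eq_square[of "\<Sum>i=1..k. X i _ - \<theta>"] sum_product)
    show "(\<lambda>g. (approx_angle n k (g, d) p r - \<theta>)\<^sup>2) \<in> borel_measurable (std_gauss T)"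
      unfolding approx_angle_def
      by (intro borel_measurable_power borel_measurable_diff borel_measurable_divide borel_measurable_sum borel_measurable_const
          borel_measurable_abs mh)
  qed (intro borel_measurable_divide borel_measurable_sum borel_measurable_times borel_measurable_diff mX borel_measurable_const)
  also have "\<dots> = (\<Sum>i=1..k. \<Sum>i'=1..k. ?E (\<lambda>g. X i g * X i' g) - \<theta> * \<theta>) / (real k)\<^sup>2"
  proof -
    have "?E (\<lambda>g. (\<Sum>i=1..k. \<Sum>i'=1..k. (X i g - \<theta>) * (X i' g - \<theta>)) / (real k)\<^sup>2)
        = (\<Sum>i=1..k. \<Sum>i'=1..k. ?E (\<lambda>g. (X i g - \<theta>) * (X i' g - \<theta>))) / (real k)\<^sup>2"
      using iY by (simp only: integral_divide_zero Bochner_Integration.integral_sum Bochner_Integration.integrable_sum)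
    also have "\<dots> = (\<Sum>i=1..k. \<Sum>i'=1..k. ?E (\<lambda>g. X i g * X i' g) - \<theta> * \<theta>) / (real k)\<^sup>2"
      by (intro arg_cong2[where f = "(/)"] sum.cong refl var)
    finally show ?thesis .
  qed
  also have "\<dots> \<le> (\<Sum>i=1..k. 1 + (\<Sum>i'\<in>{1..k} - {i}. 16 * row_correlation n k p q i i' d)) / (real k)\<^sup>2"
  proof (intro divide_right_mono sum_mono)
    fix i assume i: "i \<in> {1..k}"
    have "?E (\<lambda>g. X i g * X i g) \<le> 1"
      by (rule G.integral_le_const[OF iXX]) (simp add: bnd(2)[OF X01 X01])
    then have "?E (\<lambda>g. X i g * X i g) - \<theta> * \<theta> \<le> 1"
      using zero_le_square[of \<theta>] by linarith
    moreover have "(\<Sum>i'\<in>{1..k} - {i}. ?E (\<lambda>g. X i g * X i' g) - \<theta> * \<theta>)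
        \<le> (\<Sum>i'\<in>{1..k} - {i}. 16 * row_correlation n k p q i i' d)"
      using cov i by (intro sum_mono) auto
    ultimately show "(\<Sum>i'=1..k. ?E (\<lambda>g. X i g * X i' g) - \<theta> * \<theta>)
        \<le> 1 + (\<Sum>i'\<in>{1..k} - {i}. 16 * row_correlation n k p q i i' d)"
      using i by (subst sum.remove[of _ i]) auto
  qed simp
  also have "\<dots> = (real k + 16 * (\<Sum>i\<in>{1..k}. \<Sum>i'\<in>{1..k} - {i}. row_correlation n k p q i i' d)) / (real k)\<^sup>2"
    by (simp add: sum.distrib sum_distrib_left)
  finally show ?thesis by (simp only: T_def)
qed

section \<open>Averaging over the random signs and concluding\<close>

lemma borel_measurable_approx_angle:
  "(\<lambda>\<omega>. approx_angle n k \<omega> p r) \<in> borel_measurable (std_gauss {1..n + k - 1} \<Otimes>\<^sub>M rademacher {1..n})"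
proof -
  let ?M = "std_gauss {1..n + k - 1} \<Otimes>\<^sub>M rademacher {1..n}"
  have g: "(\<lambda>\<omega>. fst \<omega> l) \<in> borel_measurable ?M" if "l \<in> {1..n + k - 1}" for l
    using that by measurable
  have d: "(\<lambda>\<omega>. snd \<omega> j) \<in> borel_measurable ?M" if "j \<in> {1..n}" for j
    using measurable_compose[OF measurable_snd borel_measurable_rademacher[OF that]] .
  have h: "(\<lambda>\<omega>. short_hash n k \<omega> x i) \<in> borel_measurable ?M" if i: "i \<in> {1..k}" for x i
    unfolding short_hash_def toeplitz_P_def
  proof (rule measurable_compose[OF _ borel_measurable_sgn1], rule borel_measurable_sum)
    fix j assume j: "j \<in> {1..n}"
    then have "j + k - i \<in> {1..n + k - 1}" using i by auto
    from g[OF this] d[OF j] show "(\<lambda>\<omega>. fst \<omega> (j + k - i) * snd \<omega> j * x j) \<in> borel_measurable ?M"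
      by (intro borel_measurable_times borel_measurable_const)
  qed
  show ?thesis
    unfolding approx_angle_def
    by (intro borel_measurable_sum borel_measurable_divide borel_measurable_const borel_measurable_abs borel_measurable_diff h)
qed

lemma approx_angle_bounds: "0 \<le> approx_angle n k \<omega> p r" "approx_angle n k \<omega> p r \<le> 1"
proof -
  have "(\<Sum>i=1..k. \<bar>short_hash n k \<omega> p i - short_hash n k \<omega> r i\<bar>) \<le> (\<Sum>i=1..k. 2)"
    by (rule sum_mono) (auto simp: short_hash_def sgn1_def)
  then show "approx_angle n k \<omega> p r \<le> 1"
    unfolding approx_angle_def by (intro divide_le_eq_1[THEN iffD2]) (cases "k = 0", auto)
  show "0 \<le> approx_angle n k \<omega> p r"
    unfolding approx_angle_def by (simp add: sum_nonneg)
qed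

lemma expected_row_correlations_le:
  fixes k n :: nat
  assumes p: "dot {1..n} p p = 1" and q: "dot {1..n} q q = 1" "dot {1..n} p q = 0"
  defines "S \<equiv> \<lambda>d. \<Sum>i\<in>{1..k}. \<Sum>i'\<in>{1..k} - {i}. row_correlation n k p q i i' d"
  shows "integrable (rademacher {1..n}) S" "(\<integral>d. S d \<partial>rademacher {1..n}) \<le> 4 * real k"
proof -
  let ?c = "\<lambda>i i' x y d. (dot {1..n + k - 1} (hash_row n k d x i) (hash_row n k d y i'))\<^sup>2"
  have int: "integrable (rademacher {1..n}) (?c i i' x y)" if "i \<in> {1..k}" "i' \<in> {1..k} - {i}" for i i' x y
    using that by (intro row_correlation_second_moment) auto
  have pq: "p \<noteq> q" using p q by auto
  show "integrable (rademacher {1..n}) S"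
    unfolding S_def row_correlation_def using int by (intro Bochner_Integration.integrable_sum) auto
  have "(\<integral>d. S d \<partial>rademacher {1..n})
      = (\<Sum>i\<in>{1..k}. \<Sum>i'\<in>{1..k} - {i}. \<Sum>x\<in>{p, q}. \<Sum>y\<in>{p, q}. \<integral>d. ?c i i' x y d \<partial>rademacher {1..n})"
    unfolding S_def row_correlation_def using int
    by (subst Bochner_Integration.integral_sum, (intro Bochner_Integration.integrable_sum; simp), intro sum.cong refl)+ simp
  also have "\<dots> \<le> (\<Sum>i\<in>{1..k}. 4)"
  proof (rule sum_mono)
    fix i assume i: "i \<in> {1..k}"
    have "(\<Sum>i'\<in>{1..k} - {i}. \<Sum>x\<in>{p, q}. \<Sum>y\<in>{p, q}. \<integral>d. ?c i i' x y d \<partial>rademacher {1..n})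
        = (\<Sum>x\<in>{p, q}. \<Sum>y\<in>{p, q}. \<Sum>i'\<in>{1..k} - {i}. \<integral>d. ?c i i' x y d \<partial>rademacher {1..n})"
      using pq by (simp add: sum.distrib)
    \<comment> \<open>With the sum over \<open>i'\<close> innermost, each of the four choices of
      unit vectors contributes at most 1.\<close>
    also have "\<dots> \<le> (\<Sum>x\<in>{p, q}. \<Sum>y\<in>{p, q}. 1)"
    proof (intro sum_mono)
      fix x y assume "x \<in> {p, q}" "y \<in> {p, q}"
      then have "dot {1..n} x x = 1" "dot {1..n} y y = 1" using p q by auto
      then show "(\<Sum>i'\<in>{1..k} - {i}. \<integral>d. ?c i i' x y d \<partial>rademacher {1..n}) \<le> 1"
        using sum_row_correlations_le[OF i, of n x y] by simp
    qed
    also have "\<dots> = 4" using pq by simp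
    finally show "(\<Sum>i'\<in>{1..k} - {i}. \<Sum>x\<in>{p, q}. \<Sum>y\<in>{p, q}. \<integral>d. ?c i i' x y d \<partial>rademacher {1..n}) \<le> 4" .
  qed
  finally show "(\<integral>d. S d \<partial>rademacher {1..n}) \<le> 4 * real k" by simp
qed

lemma approx_angle_mean_square:
  assumes n: "2 \<le> k" "k \<le> n" and p: "dot {1..n} p p = 1" and r: "dot {1..n} r r = 1"
  defines "M \<equiv> std_gauss {1..n + k - 1} \<Otimes>\<^sub>M rademacher {1..n}"
    and "\<Delta> \<equiv> \<lambda>\<omega>. approx_angle n k \<omega> p r - arccos (dot {1..n} p r) / pi"
  shows "integrable M (\<lambda>\<omega>. (\<Delta> \<omega>)\<^sup>2)" "(\<integral>\<omega>. (\<Delta> \<omega>)\<^sup>2 \<partial>M) \<le> 65 / real k"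
proof -
  let ?G = "std_gauss {1..n + k - 1}" and ?D = "rademacher {1..n}"
  interpret G: prob_space ?G by (rule prob_space_std_gauss)
  interpret D: prob_space ?D by (rule prob_space_rademacher)
  interpret GD: pair_prob_space ?G ?D ..
  have m\<Delta>: "\<Delta> \<in> borel_measurable (?G \<Otimes>\<^sub>M ?D)"
    unfolding \<Delta>_def by (intro borel_measurable_diff borel_measurable_approx_angle borel_measurable_const)
  have "(dot {1..n} p r)\<^sup>2 \<le> 1" using dot_square_le[of "{1..n}" p r] p r by simp
  then have "-1 \<le> dot {1..n} p r" "dot {1..n} p r \<le> 1" by (auto simp: abs_square_le_1 abs_le_iff)
  then have \<theta>: "0 \<le> arccos (dot {1..n} p r) / pi" "arccos (dot {1..n} p r) / pi \<le> 1"
    by (simp_all add: arccos_lbound arccos_ubound)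
  have "\<bar>\<Delta> \<omega>\<bar> \<le> 1" for \<omega>
    using \<theta> approx_angle_bounds[of n k \<omega> p r] by (simp add: \<Delta>_def abs_le_iff del: divide_le_eq_1_pos)
  then have \<Delta>1: "(\<Delta> \<omega>)\<^sup>2 \<le> 1" for \<omega> by (simp add: abs_square_le_1)
  have int: "integrable (?G \<Otimes>\<^sub>M ?D) (\<lambda>\<omega>. (\<Delta> \<omega>)\<^sup>2)"
    by (rule GD.integrable_bounded_by[where K = 1], intro borel_measurable_power m\<Delta>) (simp add: \<Delta>1)
  then show "integrable M (\<lambda>\<omega>. (\<Delta> \<omega>)\<^sup>2)" by (simp add: M_def)
  obtain q where q: "dot {1..n} q q = 1" "dot {1..n} p q = 0"
    and r': "\<And>j. j \<in> {1..n} \<Longrightarrow> r j = dot {1..n} p r * p j + sqrt (1 - (dot {1..n} p r)\<^sup>2) * q j"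
    using orthonormal_decomposition[of "{1..n}" 1 2 p r] n p r by auto
  define S where "S = (\<lambda>d. \<Sum>i\<in>{1..k}. \<Sum>i'\<in>{1..k} - {i}. row_correlation n k p q i i' d)"
  note S = expected_row_correlations_le[OF p q, of k, folded S_def]
  have int': "integrable (?G \<Otimes>\<^sub>M ?D) (case_prod (\<lambda>g d. (\<Delta> (g, d))\<^sup>2))"
    using int by (simp add: case_prod_beta')
  \<comment> \<open>Fubini with the signs outermost: the Gaussian estimate holds at fixed signs, and
    only afterwards are the row correlations averaged.\<close>
  have "(\<integral>\<omega>. (\<Delta> \<omega>)\<^sup>2 \<partial>M) = (\<integral>d. \<integral>g. (\<Delta> (g, d))\<^sup>2 \<partial>?G \<partial>?D)"
    using GD.integral_snd[OF int'] by (simp add: M_def case_prod_beta')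
  also have "\<dots> \<le> (\<integral>d. (real k + 16 * S d) / (real k)\<^sup>2 \<partial>?D)"
  proof (rule integral_mono_AE)
    show "integrable ?D (\<lambda>d. \<integral>g. (\<Delta> (g, d))\<^sup>2 \<partial>?G)" using GD.integrable_snd[OF int'] .
    show "integrable ?D (\<lambda>d. (real k + 16 * S d) / (real k)\<^sup>2)" using S by (simp del: One_nat_def)
    show "AE d in ?D. (\<integral>g. (\<Delta> (g, d))\<^sup>2 \<partial>?G) \<le> (real k + 16 * S d) / (real k)\<^sup>2"
      using AE_rademacher[OF finite_atLeastAtMost]
    proof eventually_elim
      case (elim d)
      show ?case unfolding \<Delta>_def S_def
        by (rule conditional_second_moment[OF n elim p q r r'])
    qed
  qed
  also have "\<dots> = (real k + 16 * (\<integral>d. S d \<partial>?D)) / (real k)\<^sup>2"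
    using S by (simp add: D.prob_space del: One_nat_def)
  also have "\<dots> \<le> (real k + 16 * (4 * real k)) / (real k)\<^sup>2"
    using S by (intro divide_right_mono add_left_mono mult_left_mono) auto
  also have "\<dots> = 65 / real k" using n by (simp add: power2_eq_square field_simps)
  finally show "(\<integral>\<omega>. (\<Delta> \<omega>)\<^sup>2 \<partial>M) \<le> 65 / real k" .
qed

text \<open>Compares the mean square rate \<open>1 / x\<close> with the squared threshold. Cubing
  removes the fractional powers and leaves \<open>x * ln x\<close>, which is at least 4/3 from
  \<open>x = 2\<close> on; at \<open>x = 1\<close> the logarithm vanishes and the bound
  fails.\<close>

lemma deviation_scale:
  fixes x :: real
  assumes "2 \<le> x"
  shows "1 \<le> x * ((sqrt (ln x) / x) powr (1/3))\<^sup>2"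
proof -
  define y where "y = (sqrt (ln x) / x) powr (1/3)"
  have ln: "ln x \<ge> 2 / 3" using assms ln_mono[of 2 x] ln2_ge_two_thirds by linarith
  have "y ^ 3 = y powr 3" using assms ln by (simp add: y_def)
  also have "\<dots> = sqrt (ln x) / x" using assms ln by (simp add: y_def powr_powr)
  finally have y3: "y ^ 3 = sqrt (ln x) / x" .
  have "(x * y\<^sup>2) ^ 3 = x ^ 3 * (y ^ 3)\<^sup>2" by (simp add: power_mult_distrib flip: power_mult)
  also have "\<dots> = x * ln x"
    unfolding y3 using assms ln by (simp add: power_divide power2_eq_square power3_eq_cube)
  also have "\<dots> \<ge> 2 * (2 / 3)" using assms ln by (intro mult_mono) auto
  finally have "(x * y\<^sup>2) ^ 3 > 1" by simp
  then have "\<not> x * y\<^sup>2 \<le> 1"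
    using power_le_one[of "x * y\<^sup>2" 3] assms by auto
  then show ?thesis unfolding y_def by (rule less_imp_le[OF not_le_imp_less])
qed

theorem theorem3:
  shows "\<exists>C::real. \<forall>n k (p::nat \<Rightarrow> real) (r::nat \<Rightarrow> real) (c::real).
     2 \<le> k \<longrightarrow> k \<le> n \<longrightarrow>
     (\<Sum>i=1..n. (p i)\<^sup>2) = 1 \<longrightarrow> (\<Sum>i=1..n. (r i)\<^sup>2) = 1 \<longrightarrow> c > 0 \<longrightarrow>
     measure (hash_space n k)
       {\<omega> \<in> space (hash_space n k).
          \<bar>approx_angle n k \<omega> p r - vec_angle n p r / pi\<bar>
            \<ge> c * (sqrt (ln (real k)) / real k) powr (1/3)}
     \<le> C / c\<^sup>2"
proof (intro exI[of _ 65] allI impI)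
  fix n k :: nat and p r :: "nat \<Rightarrow> real" and c :: real
  assume n: "2 \<le> k" "k \<le> n" and "(\<Sum>i=1..n. (p i)\<^sup>2) = 1" "(\<Sum>i=1..n. (r i)\<^sup>2) = 1" and c: "c > 0"
  then have p: "dot {1..n} p p = 1" and r: "dot {1..n} r r = 1"
    by (simp_all add: dot_def power2_eq_square)
  let ?y = "(sqrt (ln (real k)) / real k) powr (1/3)"
  let ?\<Delta> = "\<lambda>\<omega>. approx_angle n k \<omega> p r - vec_angle n p r / pi"
  have space: "hash_space n k = std_gauss {1..n + k - 1} \<Otimes>\<^sub>M rademacher {1..n}"
    by (simp add: hash_space_def std_gauss_def)
  have angle: "vec_angle n p r = arccos (dot {1..n} p r)" by (simp add: vec_angle_def dot_def)
  note ms = approx_angle_mean_square[OF n p r, folded space angle]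
  have y: "?y > 0" using n by simp
  have scale: "1 \<le> real k * ?y\<^sup>2" using deviation_scale[of "real k"] n by simp
  \<comment> \<open>Squaring the event turns Markov's inequality into Chebyshev's, centred at
    \<open>\<theta> / pi\<close>.\<close>
  have "{\<omega> \<in> space (hash_space n k). \<bar>?\<Delta> \<omega>\<bar> \<ge> c * ?y} = {\<omega> \<in> space (hash_space n k). (c * ?y)\<^sup>2 \<le> (?\<Delta> \<omega>)\<^sup>2}"
    using c y by (auto simp: abs_le_square_iff[symmetric] simp flip: abs_of_pos)
  then have "measure (hash_space n k) {\<omega> \<in> space (hash_space n k). \<bar>?\<Delta> \<omega>\<bar> \<ge> c * ?y}
      \<le> (\<integral>\<omega>. (?\<Delta> \<omega>)\<^sup>2 \<partial>hash_space n k) / (c * ?y)\<^sup>2"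
    using integral_Markov_inequality_measure[OF ms(1), of "{}" "(c * ?y)\<^sup>2"] c y by simp
  also have "\<dots> \<le> (65 / real k) / (c * ?y)\<^sup>2"
    using ms(2) by (intro divide_right_mono) auto
  also have "\<dots> = 65 / (c\<^sup>2 * (real k * ?y\<^sup>2))" by (simp add: power_mult_distrib mult_ac)
  also have "\<dots> \<le> 65 / (c\<^sup>2 * 1)"
    using n c scale by (intro divide_left_mono mult_left_mono mult_pos_pos) auto
  finally show "measure (hash_space n k) {\<omega> \<in> space (hash_space n k). \<bar>?\<Delta> \<omega>\<bar> \<ge> c * ?y} \<le> 65 / c\<^sup>2"
    by simp
qed

end
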